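(* Suppose $f$ satisfies (F1), (F2), (F3), (F4). Let $q>3$, let $\rho_K\in L^q(K)$ be non-negative and axisymmetric, and let $\Phi_K(\mathbf{x})=\int_K\frac{\rho_K(\mathbf{y})}{|\mathbf{x}-\mathbf{y}|}d\mathbf{y}$. Assume $K$ satisfies the no-trapping condition: whenever $(x,y,z)\in\mathbb{R}^3\setminus K$, the half line $\{(x,y,z)+t(x,y,0):t\ge0\}$ is contained in $\mathbb{R}^3\setminus K$. Let $M>0$. Then there exists $\Omega_0>0$ such that for every constant $\Omega>\Omega_0$ there is no bounded continuous function $\rho:\mathbb{R}^3\setminus K\to[0,\infty)$ with $\int_{\mathbb{R}^3\setminus K}\rho\,d\mathbf{x}=M$ for which there is a constant $\lambda$ with $$A'(\rho)-B\rho-\tfrac12\Omega^2r^2-\Phi_K=\lambda\quad\text{on the set where }\rho>0.$$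
   Context: $K\subset\mathbb{R}^3$ is a bounded axisymmetric domain (axisymmetric means invariant under all rotations about the $x_3$-axis). Write $r=r(\mathbf{x})=\sqrt{x_1^2+x_2^2}$. For a function $\rho$ on $\mathbb{R}^3\setminus K$, $B\rho(\mathbf{x})=\int_{\mathbb{R}^3\setminus K}\frac{\rho(\mathbf{y})}{|\mathbf{x}-\mathbf{y}|}\,d\mathbf{y}$. Conditions on $f:[0,\infty)\to[0,\infty)$: (F1) $f$ is non-negative, continuous, and strictly increasing for $s>0$; (F2) $\lim_{s\to0}f(s)s^{-4/3}=0$ and $\lim_{s\to\infty}f(s)s^{-4/3}=\infty$; (F3) $\liminf_{s\to\infty}f(s)s^{-\gamma}>0$ for some $\gamma>4/3$; (F4) $f$ is continuously differentiable on $(0,\infty)$ and $\liminf_{s\to0}f'(s)s^{-\mu}>0$ for some $\mu>0$. $A(s)=s\int_0^s\frac{f(t)}{t^2}dt$, so $A'(s)=\int_0^s\frac{f(t)}{t^2}dt+\frac{f(s)}{s}$. *)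

theory Defs
  imports "HOL-Analysis.Analysis"
begin

definition rad :: "real^3 \<Rightarrow> real" where
  "rad x = sqrt ((x$1)^2 + (x$2)^2)"

definition rot3 :: "real \<Rightarrow> real^3 \<Rightarrow> real^3" where
  "rot3 \<theta> x = vector [cos \<theta> * x$1 - sin \<theta> * x$2, sin \<theta> * x$1 + cos \<theta> * x$2, x$3]"

definition axisym_set :: "(real^3) set \<Rightarrow> bool" where
  "axisym_set K \<longleftrightarrow> (\<forall>\<theta> x. x \<in> K \<longleftrightarrow> rot3 \<theta> x \<in> K)"

definition axisym_fun_on :: "(real^3) set \<Rightarrow> (real^3 \<Rightarrow> real) \<Rightarrow> bool" where
  "axisym_fun_on K g \<longleftrightarrow> (\<forall>\<theta>. \<forall>x\<in>K. g (rot3 \<theta> x) = g x)"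

definition Bop :: "(real^3) set \<Rightarrow> (real^3 \<Rightarrow> real) \<Rightarrow> real^3 \<Rightarrow> real" where
  "Bop K \<rho> x = integral (- K) (\<lambda>y. \<rho> y / dist x y)"

definition PhiK :: "(real^3) set \<Rightarrow> (real^3 \<Rightarrow> real) \<Rightarrow> real^3 \<Rightarrow> real" where
  "PhiK K \<rho>K x = integral K (\<lambda>y. \<rho>K y / dist x y)"

definition Aprime :: "(real \<Rightarrow> real) \<Rightarrow> real \<Rightarrow> real" where
  "Aprime f s = integral {0..s} (\<lambda>t. f t / t^2) + f s / s"

definition F1 :: "(real \<Rightarrow> real) \<Rightarrow> bool" where
  "F1 f \<longleftrightarrow> (\<forall>s\<ge>0. f s \<ge> 0) \<and> continuous_on {0..} f \<and> strict_mono_on {0<..} f"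

definition F2 :: "(real \<Rightarrow> real) \<Rightarrow> bool" where
  "F2 f \<longleftrightarrow> ((\<lambda>s. f s / s powr (4/3)) \<longlongrightarrow> 0) (at_right 0)
             \<and> filterlim (\<lambda>s. f s / s powr (4/3)) at_top at_top"

definition F3 :: "(real \<Rightarrow> real) \<Rightarrow> bool" where
  "F3 f \<longleftrightarrow> (\<exists>\<gamma>>4/3. Liminf at_top (\<lambda>s. ereal (f s / s powr \<gamma>)) > 0)"

definition F4 :: "(real \<Rightarrow> real) \<Rightarrow> bool" where
  "F4 f \<longleftrightarrow> (\<forall>s>0. f differentiable (at s)) \<and> continuous_on {0<..} (deriv f)
             \<and> (\<exists>\<mu>>0. Liminf (at_right 0) (\<lambda>s. ereal (deriv f s / s powr \<mu>)) > 0)"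

definition no_trapping :: "(real^3) set \<Rightarrow> bool" where
  "no_trapping K \<longleftrightarrow> (\<forall>p. p \<notin> K \<longrightarrow> (\<forall>t\<ge>0. p + t *\<^sub>R vector [p$1, p$2, 0] \<notin> K))"

end

theory Submission
  imports Defs
begin

text \<open>
  Write \<open>g = B \<rho> + \<Omega>\<^sup>2 r\<^sup>2 / 2 + \<Phi>\<close>, so that \<open>A' \<circ> \<rho> = g + c\<close> where \<open>\<rho> > 0\<close>. If \<open>\<rho> p > 0\<close> off the axis, then
  \<open>\<rho>\<close> takes every value in \<open>(0, \<rho> p)\<close> on the outward horizontal ray from \<open>p\<close>: otherwise the
  centrifugal term would make \<open>A' \<circ> \<rho>\<close> unbounded along that ray. So \<open>g\<close> must drop along the ray.
  As \<open>B \<rho> \<le> C S\<^sup>1\<^sup>/\<^sup>3\<close> with \<open>S = sup \<rho>\<close>, while \<open>A'\<close> outgrows the cube root, such a drop bounds \<open>S\<close>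
  independently of \<open>\<Omega>\<close>; and as \<open>B \<rho>\<close> and \<open>\<Phi>\<close> are then uniformly Lipschitz, the star lies in a cylinder of
  radius \<open>O(\<Omega>\<^sup>-\<^sup>2)\<close>.

  If the star avoids a neighbourhood of \<open>K\<close>, the axial symmetry of \<open>\<Phi>\<close> gives \<open>\<partial>\<^sub>r \<Phi> \<ge> -C r\<close> on it. Let \<open>R\<close> be
  the largest distance to the axis in the star: the inward pull of the star on its points with \<open>r > R/2\<close>
  is at most \<open>C S R\<close>, because the star is confined to the cylinder of radius \<open>R\<close>. For large \<open>\<Omega>\<close> the function
  \<open>g\<close> increases along the ray through such a point, a contradiction. If the star does come close to \<open>K\<close>
  (and \<open>\<Phi> \<noteq> 0\<close>), then \<open>-c\<close> is bounded below, and since \<open>B \<rho>\<close> is tiny for a thin star, \<open>\<Phi>\<close> is bounded below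
  on the whole star. So the star is bounded, hence of tiny volume, contradicting its mass \<open>M\<close>.
\<close>

section \<open>Kernel estimates\<close>

text \<open>At each point a single layer dominates \<open>h\<close>, and all terms are nonnegative.
  Hence \<open>h\<close> lies below the whole series, which is integrated term by term; the layers
  may overlap.\<close>

lemma nn_integral_le_layers:
  fixes h :: "'a \<Rightarrow> real" and c v :: "nat \<Rightarrow> real"
  assumes meas: "\<And>k. A k \<in> sets M"
    and vol: "\<And>k. emeasure M (A k) \<le> ennreal (v k)"
    and nonneg: "\<And>k. c k \<ge> 0" "\<And>k. v k \<ge> 0"
    and cover: "\<And>y. h y \<le> 0 \<or> (\<exists>k. y \<in> A k \<and> h y \<le> c k)"
    and sums: "(\<lambda>k. c k * v k) sums s"
  shows "(\<integral>\<^sup>+y. ennreal (h y) \<partial>M) \<le> ennreal s"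
proof -
  have "(\<integral>\<^sup>+y. ennreal (h y) \<partial>M) \<le> (\<integral>\<^sup>+y. (\<Sum>k. ennreal (c k) * indicator (A k) y) \<partial>M)"
  proof (rule nn_integral_mono)
    fix y
    show "ennreal (h y) \<le> (\<Sum>k. ennreal (c k) * indicator (A k) y)"
    proof (cases "h y \<le> 0")
      case True
      then show ?thesis by (simp add: ennreal_neg)
    next
      case False
      then obtain k where k: "y \<in> A k" "h y \<le> c k" using cover by blast
      have "ennreal (h y) \<le> ennreal (c k) * indicator (A k) y"
        using k by (simp add: ennreal_leI)
      also have "\<dots> = (\<Sum>i\<in>{k}. ennreal (c i) * indicator (A i) y)"
        by (simp only: sum.insert[OF finite.emptyI] sum.empty empty_iff not_False_eq_True add_0_right)
      also have "\<dots> \<le> (\<Sum>i. ennreal (c i) * indicator (A i) y)"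
        by (rule sum_le_suminf) auto
      finally show ?thesis .
    qed
  qed
  also have "\<dots> = (\<Sum>k. \<integral>\<^sup>+y. ennreal (c k) * indicator (A k) y \<partial>M)"
    using meas by (intro nn_integral_suminf) auto
  also have "\<dots> = (\<Sum>k. ennreal (c k) * emeasure M (A k))"
    using meas by (simp add: nn_integral_cmult_indicator)
  also have "\<dots> \<le> (\<Sum>k. ennreal (c k * v k))"
    using vol nonneg by (intro suminf_le) (auto simp: ennreal_mult intro: mult_left_mono)
  also have "\<dots> = ennreal s"
    using sums nonneg by (subst suminf_ennreal_eq[OF _ sums]) auto
  finally show ?thesis .
qed

lemma integrable_le_layers:
  fixes h :: "'a \<Rightarrow> real" and c v :: "nat \<Rightarrow> real"
  assumes "h \<in> borel_measurable M" "\<And>y. h y \<ge> 0"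
    and "\<And>k. A k \<in> sets M"
    and "\<And>k. emeasure M (A k) \<le> ennreal (v k)"
    and "\<And>k. c k \<ge> 0" "\<And>k. v k \<ge> 0"
    and "\<And>y. h y \<le> 0 \<or> (\<exists>k. y \<in> A k \<and> h y \<le> c k)"
    and sums: "(\<lambda>k. c k * v k) sums s"
  shows "integrable M h" and "integral\<^sup>L M h \<le> s"
proof -
  have le: "(\<integral>\<^sup>+y. ennreal (h y) \<partial>M) \<le> ennreal s"
    by (rule nn_integral_le_layers[where A=A and c=c and v=v]) (use assms in auto)
  then have "(\<integral>\<^sup>+y. ennreal (h y) \<partial>M) < \<infinity>"
    using ennreal_less_top le_less_trans by fastforce
  then show int: "integrable M h"
    using assms by (intro integrableI_nonneg) auto
  have "s \<ge> 0"
    using sums_le[OF _ sums_zero sums] assms(5,6) by simp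
  then show "integral\<^sup>L M h \<le> s"
    using le assms(2) by (simp add: nn_integral_eq_integral[OF int])
qed

lemma emeasure_ball_real3:
  fixes x :: "real^3"
  assumes "a \<ge> 0"
  shows "emeasure lebesgue (ball x a) = ennreal (unit_ball_vol 3 * a ^ 3)"
  using emeasure_ball[OF assms, of x] by simp

lemma geometric_sums_cmult:
  fixes q :: real
  assumes "\<bar>q\<bar> < 1" "\<And>k. F k = b * q ^ k"
  shows "F sums (b / (1 - q))"
proof -
  have "F = (\<lambda>k. b * q ^ k)" using assms(2) by (rule ext)
  then show ?thesis using sums_mult[OF geometric_sums[of q], of b] assms(1) by simp
qed

text \<open>Dyadic shells: between the radii \<open>a / 2^(Suc k)\<close> and \<open>a / 2^k\<close>
  the kernel is at most its value at the inner radius. Kernel bound times volume is geometric with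
  ratio \<open>2 powr (s - 3)\<close>, which is below 1 because \<open>s < 3\<close>. Scaling makes
  \<open>C\<close> independent of centre and radius.\<close>

lemma riesz_kernel_near_bound:
  fixes s :: real
  assumes s: "0 < s" "s < 3"
  obtains C where "C \<ge> 0"
    "\<And>(x::real^3) a. a > 0 \<Longrightarrow> integrable lebesgue (\<lambda>y. indicator (ball x a) y * dist x y powr (-s))"
    "\<And>(x::real^3) a. a > 0 \<Longrightarrow>
       integral\<^sup>L lebesgue (\<lambda>y. indicator (ball x a) y * dist x y powr (-s)) \<le> C * a powr (3-s)"
proof -
  define V where "V = unit_ball_vol 3"
  define Q where "Q = (2::real) powr (s - 3)"
  define C where "C = 2 powr s * V / (1 - Q)"
  have V: "V \<ge> 0" by (simp add: V_def)
  have Q: "0 < Q" "Q < 1" using s by (auto simp: Q_def powr_less_one)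
  have *: "integrable lebesgue (\<lambda>y. indicator (ball x a) y * dist x y powr (-s))
     \<and> integral\<^sup>L lebesgue (\<lambda>y. indicator (ball x a) y * dist x y powr (-s)) \<le> C * a powr (3-s)"
    if a: "a > 0" for x :: "real^3" and a
  proof -
    define A where "A = (\<lambda>k::nat. ball x (a / 2^k))"
    define c where "c = (\<lambda>k::nat. (a / 2^(Suc k)) powr (-s))"
    define v where "v = (\<lambda>k::nat. V * (a / 2^k)^3)"
    have cov: "indicator (ball x a) y * dist x y powr (-s) \<le> 0
       \<or> (\<exists>k. y \<in> A k \<and> indicator (ball x a) y * dist x y powr (-s) \<le> c k)" for y
    proof (cases "y \<in> ball x a \<and> y \<noteq> x")
      \<comment> \<open>The centre \<open>y = x\<close> falls under this case, since
        \<open>0 powr (-s) = 0\<close>.\<close>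
      case False
      then show ?thesis by (auto simp: indicator_def)
    next
      case True
      then have d: "0 < dist x y" "dist x y < a" by auto
      have "\<exists>k. a / 2^k \<le> dist x y"
      proof -
        obtain k where "a / dist x y < 2 ^ k"
          using real_arch_pow[of 2 "a / dist x y"] by auto
        then show ?thesis using d by (intro exI[of _ k]) (simp add: field_simps)
      qed
      then obtain k where k: "a / 2^k \<le> dist x y" "\<And>j. j < k \<Longrightarrow> \<not> a / 2^j \<le> dist x y"
        using exists_least_iff[of "\<lambda>k. a / 2^k \<le> dist x y"] by auto
      have "k \<noteq> 0" using k(1) d by (intro notI) simp
      then obtain j where j: "k = Suc j" by (cases k) auto
      have "y \<in> A j" using k(2)[of j] j by (simp add: A_def)
      moreover have "dist x y powr (-s) \<le> c j"
        unfolding c_def using k(1) j s a by (intro powr_mono2') auto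
      ultimately show ?thesis using True by auto
    qed
    have "c k * v k = 2 powr s * V * a powr (3-s) * Q ^ k" for k
    proof -
      have "c k = a powr (-s) * (2 powr s * (2 powr s) ^ k)"
        using a by (simp add: c_def powr_divide powr_minus_divide powr_mult powr_realpow[symmetric] powr_powr powr_add
              field_simps)
      moreover have "v k = V * (a powr 3) * (2 powr (-3))^k"
      proof -
        have "((2::real) ^ k) ^ 3 = (2 ^ 3) ^ k"
          by (simp only: power_mult[symmetric] mult.commute)
        then show ?thesis using a by (simp add: v_def power_divide powr_minus_divide)
      qed
      moreover have "Q ^ k = (2 powr s) ^ k * (2 powr (-3))^k"
        by (simp add: Q_def power_mult_distrib[symmetric] powr_add[symmetric])
      moreover have "a powr (3-s) = a powr 3 * a powr (-s)"
        by (simp add: powr_add[symmetric])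
      ultimately show ?thesis by (simp only: mult_ac)
    qed
    then have sm: "(\<lambda>k. c k * v k) sums (2 powr s * V * a powr (3-s) / (1 - Q))"
      using Q by (intro geometric_sums_cmult) auto
    have v: "v k \<ge> 0" for k using a V by (simp add: v_def)
    have c: "c k \<ge> 0" for k by (simp add: c_def)
    have "(\<lambda>y. indicator (ball x a) y * dist x y powr (-s)) \<in> borel_measurable borel"
      by (intro borel_measurable_times borel_measurable_indicator) (auto intro: powr_real_measurable)
    then have m: "(\<lambda>y. indicator (ball x a) y * dist x y powr (-s)) \<in> borel_measurable lebesgue"
      by (simp add: measurable_completion)
    have em: "emeasure lebesgue (A k) \<le> ennreal (v k)" for k
      using emeasure_ball_real3[of "a/2^k" x] a by (simp add: A_def v_def V_def)
    have Am: "A k \<in> sets lebesgue" for k by (simp add: A_def)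
    note L = integrable_le_layers[OF m _ Am em c v cov sm]
    show ?thesis using L by (simp add: C_def field_simps)
  qed
  have "C \<ge> 0" using V Q by (simp add: C_def)
  then show thesis using * that by blast
qed

section \<open>Kernels on thin cylinders around the axis\<close>

lemma abs_nth_le_rad: "\<bar>y$1\<bar> \<le> rad y" "\<bar>y$2\<bar> \<le> rad y"
  by (auto simp: rad_def intro!: real_le_rsqrt)

lemma rad_nonneg [simp]: "rad x \<ge> 0"
  by (simp add: rad_def)

lemma borel_measurable_rad [measurable]: "rad \<in> borel_measurable borel"
  unfolding rad_def by (intro borel_measurable_continuous_onI continuous_intros)

lemma emeasure_cylinder_segment_le:
  assumes "R \<ge> 0" "h \<ge> 0"
  shows "emeasure lebesgue {y::real^3. rad y \<le> R \<and> \<bar>y$3 - z\<bar> \<le> h} \<le> ennreal (8 * R\<^sup>2 * h)"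
proof -
  define l u :: "real^3" where "l = vector [-R, -R, z - h]" and "u = vector [R, R, z + h]"
  have sub: "{y::real^3. rad y \<le> R \<and> \<bar>y$3 - z\<bar> \<le> h} \<subseteq> cbox l u"
  proof
    fix y :: "real^3" assume "y \<in> {y. rad y \<le> R \<and> \<bar>y$3 - z\<bar> \<le> h}"
    then show "y \<in> cbox l u"
      using abs_nth_le_rad[of y] by (auto simp: mem_box_cart forall_3 l_def u_def)
  qed
  have ne: "cbox l u \<noteq> {}" using assms
    by (auto simp: interval_ne_empty_cart forall_3 l_def u_def)
  have "emeasure lebesgue (cbox l u) = ennreal (measure lborel (cbox l u))"
    using emeasure_lborel_cbox_finite[of l u] by (simp add: emeasure_eq_ennreal_measure)
  also have "measure lborel (cbox l u) = 8 * R\<^sup>2 * h"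
  proof -
    have "measure lborel (cbox l u) = (\<Prod>i\<in>{1,2,3}. u$i - l$i)"
      using content_cbox_cart[OF ne] by (simp only: UNIV_3)
    also have "\<dots> = (R + R) * ((R + R) * (h + h))"
      by (simp add: l_def u_def)
    finally show ?thesis by (simp add: power2_eq_square algebra_simps)
  qed
  finally have "emeasure lebesgue (cbox l u) = ennreal (8 * R\<^sup>2 * h)" .
  moreover have "emeasure lebesgue {y::real^3. rad y \<le> R \<and> \<bar>y$3 - z\<bar> \<le> h} \<le> emeasure lebesgue (cbox l u)"
    by (rule emeasure_mono[OF sub]) simp
  ultimately show ?thesis by simp
qed


text \<open>Majorant of the difference quotient of the inverse distance \<open>1 / m\<close> for a
  horizontal move inside a cylinder of radius \<open>R\<close>. Close by it is the usual inverse
  square. Further out, a move of length \<open>d\<close> increases the squared distance by at most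
  \<open>4 * R * d\<close>, which yields \<open>4 * R / m ^ 3\<close>.\<close>

definition cyl_kernel :: "real \<Rightarrow> real \<Rightarrow> real" where
  "cyl_kernel R m = (if m < R then 1 / m\<^sup>2 else 4 * R / m ^ 3)"

lemma cyl_kernel_nonneg: "R \<ge> 0 \<Longrightarrow> m \<ge> 0 \<Longrightarrow> cyl_kernel R m \<ge> 0"
  by (simp add: cyl_kernel_def)

lemma borel_measurable_cyl_kernel [measurable]: "cyl_kernel R \<in> borel_measurable borel"
  unfolding cyl_kernel_def by measurable

text \<open>Dyadic cylinder segments: their volume doubles from one to the next while the kernel
  drops by a factor 8, so the series has ratio 1/4 and first term \<open>64 * R\<close>.\<close>

lemma cylinder_far_kernel_bound:
  fixes x :: "real^3"
  assumes R: "R > 0"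
  defines "h \<equiv> \<lambda>y. if rad y \<le> R \<and> R \<le> dist x y then 4 * R / dist x y ^ 3 else 0"
  shows "integrable lebesgue h" and "integral\<^sup>L lebesgue h \<le> 256/3 * R"
proof -
  define A where "A = (\<lambda>k::nat. {y::real^3. rad y \<le> R \<and> \<bar>y$3 - x$3\<bar> \<le> 2^(Suc k) * R})"
  define c where "c = (\<lambda>k::nat. 4 * R / (2^k * R)^3)"
  define v where "v = (\<lambda>k::nat. 8 * R\<^sup>2 * (2^(Suc k) * R))"
  have cov: "h y \<le> 0 \<or> (\<exists>k. y \<in> A k \<and> h y \<le> c k)" for y
  proof (cases "rad y \<le> R \<and> R \<le> dist x y")
    case False
    then show ?thesis by (auto simp: h_def)
  next
    case True
    then have d: "rad y \<le> R" "R \<le> dist x y" by auto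
    have "\<exists>k. dist x y < 2^k * R"
    proof -
      obtain k where "dist x y / R < 2 ^ k"
        using real_arch_pow[of 2 "dist x y / R"] by auto
      then show ?thesis using R by (intro exI[of _ k]) (simp add: field_simps)
    qed
    then obtain k where k: "dist x y < 2^k * R" "\<And>j. j < k \<Longrightarrow> \<not> dist x y < 2^j * R"
      using exists_least_iff[of "\<lambda>k. dist x y < 2^k * R"] by auto
    have "k \<noteq> 0" using k(1) d by (intro notI) simp
    then obtain j where j: "k = Suc j" by (cases k) auto
    have "\<bar>y$3 - x$3\<bar> \<le> dist x y"
      using component_le_norm_cart[of "x - y" 3] by (simp add: dist_norm abs_minus_commute)
    then have "y \<in> A j" using k(1) j d(1) by (simp add: A_def)
    moreover have "h y \<le> c j"
      unfolding c_def h_def using k(2)[of j] j R True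
      by (auto intro!: divide_left_mono power_mono mult_pos_pos)
    ultimately show ?thesis by auto
  qed
  have "c k * v k = 64 * R * (1/4)^k" for k
  proof -
    have "((2::real) ^ k) ^ 3 = 2^k * 4 ^ k"
    proof -
      have "((2::real) ^ k) ^ 3 = (2 ^ 3) ^ k"
        by (simp only: power_mult[symmetric] mult.commute)
      also have "\<dots> = 2^k * 4 ^ k" by (simp add: power_mult_distrib[symmetric])
      finally show ?thesis .
    qed
    then show ?thesis using R
      by (simp add: c_def v_def power_mult_distrib power_divide power2_eq_square power3_eq_cube)
  qed
  then have sm: "(\<lambda>k. c k * v k) sums (64 * R / (1 - 1/4))"
    by (intro geometric_sums_cmult) auto
  have v: "v k \<ge> 0" for k using R by (simp add: v_def)
  have c: "c k \<ge> 0" for k using R by (simp add: c_def)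
  have m: "h \<in> borel_measurable lebesgue"
    unfolding h_def by (intro measurable_completion) measurable
  have em: "emeasure lebesgue (A k) \<le> ennreal (v k)" for k
    using emeasure_cylinder_segment_le[of R "2^(Suc k)*R" "x$3"] R by (simp add: A_def v_def)
  have "A k \<in> sets borel" for k
    unfolding A_def by measurable
  then have Am: "A k \<in> sets lebesgue" for k by simp
  have h: "h y \<ge> 0" for y using R by (simp add: h_def)
  note L = integrable_le_layers[OF m h Am em c v cov sm]
  show "integrable lebesgue h" "integral\<^sup>L lebesgue h \<le> 256/3 * R"
    using L by simp_all
qed

text \<open>Split at distance \<open>R\<close>: the near part is the Riesz kernel with exponent 2 on
  a ball of radius \<open>R\<close>, the far part is the previous bound. The linear dependence on
  \<open>R\<close> later makes the self-attraction of a thin star of order \<open>R\<close>.\<close>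

lemma cylinder_kernel_bound:
  obtains C where "C \<ge> 0"
    "\<And>(x::real^3) R. R > 0 \<Longrightarrow>
       integrable lebesgue (\<lambda>y. indicator {y. rad y \<le> R} y * cyl_kernel R (dist x y))"
    "\<And>(x::real^3) R. R > 0 \<Longrightarrow>
       integral\<^sup>L lebesgue (\<lambda>y. indicator {y. rad y \<le> R} y * cyl_kernel R (dist x y)) \<le> C * R"
proof -
  obtain C2 where C2: "C2 \<ge> 0"
    "\<And>(x::real^3) a. a > 0 \<Longrightarrow> integrable lebesgue (\<lambda>y. indicator (ball x a) y * dist x y powr (-2))"
    "\<And>(x::real^3) a. a > 0 \<Longrightarrow>
       integral\<^sup>L lebesgue (\<lambda>y. indicator (ball x a) y * dist x y powr (-2)) \<le> C2 * a powr (3-2)"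
    using riesz_kernel_near_bound[of 2] by auto
  have *: "integrable lebesgue (\<lambda>y. indicator {y. rad y \<le> R} y * cyl_kernel R (dist x y))
     \<and> integral\<^sup>L lebesgue (\<lambda>y. indicator {y. rad y \<le> R} y * cyl_kernel R (dist x y)) \<le> (C2 + 256/3) * R"
    if R: "R > 0" for x :: "real^3" and R
  proof -
    define h where "h = (\<lambda>y. if rad y \<le> R \<and> R \<le> dist x y then 4 * R / dist x y ^ 3 else 0)"
    define n where "n = (\<lambda>y. indicator (ball x R) y * dist x y powr (-2))"
    define k where "k = (\<lambda>y. indicator {y. rad y \<le> R} y * cyl_kernel R (dist x y))"
    note hb = cylinder_far_kernel_bound[OF R, of x, folded h_def]
    have nb: "integrable lebesgue n" "integral\<^sup>L lebesgue n \<le> C2 * R"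
      using C2(2,3)[OF R, of x] R by (auto simp: n_def)
    have le: "k y \<le> n y + h y" for y
      using R by (auto simp: k_def n_def h_def cyl_kernel_def indicator_def powr_minus_divide)
    have k0: "k y \<ge> 0" for y using R by (simp add: k_def cyl_kernel_nonneg)
    have m: "k \<in> borel_measurable lebesgue"
      unfolding k_def by (intro measurable_completion) measurable
    have int: "integrable lebesgue k"
      by (rule Bochner_Integration.integrable_bound[OF Bochner_Integration.integrable_add[OF nb(1) hb(1)] m])
        (use le k0 in \<open>auto intro!: AE_I2 simp: abs_of_nonneg intro: order_trans[OF _ abs_ge_self]\<close>)
    have "integral\<^sup>L lebesgue k \<le> integral\<^sup>L lebesgue (\<lambda>y. n y + h y)"
      using int nb hb le by (intro integral_mono) auto
    also have "\<dots> \<le> (C2 + 256/3) * R"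
      using nb hb by (simp add: algebra_simps)
    finally show ?thesis using int by (simp add: k_def)
  qed
  show thesis by (rule that[of "C2 + 256/3"]) (use * C2(1) in auto)
qed

section \<open>Newtonian potentials\<close>

definition newton_potential :: "(real^3 \<Rightarrow> real) \<Rightarrow> real^3 \<Rightarrow> real" where
  "newton_potential w x = (\<integral>y. w y / dist x y \<partial>lebesgue)"

text \<open>The inverse square dominates the gradient of the Newtonian kernel, so a bound on its
  integral that is uniform in \<open>x\<close> makes the potential bounded and Lipschitz with
  constant \<open>L\<close>.\<close>

locale tame_density =
  fixes w :: "real^3 \<Rightarrow> real" and L :: real
  assumes nonneg: "w y \<ge> 0"
    and integrable: "integrable lebesgue w"
    and integrable_sq: "integrable lebesgue (\<lambda>y. w y / (dist x y)\<^sup>2)"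
    and integral_sq_le: "(\<integral>y. w y / (dist x y)\<^sup>2 \<partial>lebesgue) \<le> L"

lemma borel_measurable_lebesgue_dist [measurable]:
  "(\<lambda>y. dist (x::'a::euclidean_space) y) \<in> borel_measurable lebesgue"
  by (intro measurable_completion) simp

lemma integrable_nonneg_le_AE:
  fixes g h :: "'a \<Rightarrow> real"
  assumes "integrable M h" "g \<in> borel_measurable M" "AE y in M. 0 \<le> g y \<and> g y \<le> h y"
  shows "integrable M g" "integral\<^sup>L M g \<le> integral\<^sup>L M h"
proof -
  show int: "integrable M g"
    by (rule Bochner_Integration.integrable_bound[OF assms(1,2)]) (use assms(3) in auto)
  show "integral\<^sup>L M g \<le> integral\<^sup>L M h"
    by (rule integral_mono_AE[OF int assms(1)]) (use assms(3) in auto)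
qed

lemma inverse_le_one_plus_inverse_sq:
  fixes m :: real assumes "m \<ge> 0"
  shows "1 / m \<le> 1 + 1 / m\<^sup>2"
proof (cases "m = 0")
  case False
  have "m \<le> m\<^sup>2 + 1"
    using zero_le_power2[of "m - 1/2"] by (simp add: power2_eq_square algebra_simps)
  then show ?thesis using False assms by (simp add: field_simps power2_eq_square)
qed auto

text \<open>The bound is one-sided, so that it involves the first distance only: the left side is
  positive with \<open>b > 0\<close> only if \<open>a < b\<close>, and then \<open>a * b\<close> is
  at least \<open>a * a\<close>. Under \<open>1 / 0 = 0\<close>, the case \<open>b = 0\<close> holds
  because then \<open>a \<le> d\<close>.\<close>

lemma inverse_diff_le:
  fixes a b d :: real
  assumes "a \<ge> 0" "b \<ge> 0" "\<bar>a - b\<bar> \<le> d"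
  shows "1/a - 1/b \<le> d / a\<^sup>2"
proof -
  consider "a = 0" | "a > 0" "b = 0" | "a > 0" "b > 0" "b \<le> a" | "a > 0" "a < b"
    using assms by linarith
  then show ?thesis
  proof cases
    case 1 then show ?thesis using assms by simp
  next
    case 2 then show ?thesis using assms by (simp add: field_simps power2_eq_square)
  next
    case 3
    then have "1/a - 1/b \<le> 0" by (simp add: field_simps)
    also have "0 \<le> d / a\<^sup>2" using assms by simp
    finally show ?thesis .
  next
    case 4
    have "1/a - 1/b = (b - a) / (a * b)" using 4 by (simp add: field_simps)
    also have "\<dots> \<le> d / (a * b)" using 4 assms by (intro divide_right_mono) auto
    also have "\<dots> \<le> d / (a * a)" using 4 assms by (intro divide_left_mono mult_left_mono mult_pos_pos) auto
    finally show ?thesis by (simp add: power2_eq_square)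
  qed
qed

text \<open>For \<open>a \<ge> R\<close> write \<open>1/a - 1/b\<close> as the difference of the
  squares over \<open>a * b * (a + b)\<close>; the numerator is at most \<open>4 * R * d\<close> and
  the denominator at least \<open>a^3\<close>.\<close>

lemma inverse_diff_le_cyl_kernel:
  fixes a b d R :: real
  assumes "a \<ge> 0" "b \<ge> 0" "\<bar>a - b\<bar> \<le> d" "d \<le> R" "b\<^sup>2 - a\<^sup>2 \<le> 4 * R * d"
  shows "1/a - 1/b \<le> d * cyl_kernel R a"
proof (cases "a < R")
  case True
  then show ?thesis using inverse_diff_le[OF assms(1-3)] by (simp add: cyl_kernel_def)
next
  case False
  have d: "d \<ge> 0" and R: "R \<ge> 0" using assms by auto
  have k: "d * cyl_kernel R a = 4 * R * d / a^3" using False by (simp add: cyl_kernel_def)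
  consider "a = 0" | "a > 0" "b = 0" | "a > 0" "b > 0" "b \<le> a" | "a > 0" "a < b"
    using assms by linarith
  then show ?thesis
  proof cases
    case 1
    then have "d * cyl_kernel R a = 0" using k by simp
    moreover have "1/a - 1/b \<le> 0" using 1 assms by simp
    ultimately show ?thesis by linarith
  next
    case 2
    \<comment> \<open>Here \<open>a \<le> d \<le> R \<le> a\<close>, so all three coincide.\<close>
    then have "a = d" "R = d" using assms False by auto
    then show ?thesis using 2 k by (simp add: field_simps power3_eq_cube)
  next
    case 3
    then have "1/a - 1/b \<le> 0" by (simp add: field_simps)
    also have "0 \<le> 4 * R * d / a^3" using assms d R by simp
    finally show ?thesis using k by simp
  next
    case 4
    have pos: "0 < a^3" "0 < a * b * (a + b)" using 4 by auto
    have "1/a - 1/b = (b\<^sup>2 - a\<^sup>2) / (a * b * (a + b))"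
    proof -
      have "1/a - 1/b = (b - a) / (a * b)" using 4 by (simp add: field_simps)
      also have "\<dots> = ((b - a) * (a + b)) / ((a * b) * (a + b))" using 4 by simp
      also have "(b - a) * (a + b) = b\<^sup>2 - a\<^sup>2" by (simp add: power2_eq_square algebra_simps)
      finally show ?thesis .
    qed
    also have "\<dots> \<le> (4 * R * d) / (a * b * (a + b))"
      using pos assms by (intro divide_right_mono) auto
    also have "\<dots> \<le> (4 * R * d) / a^3"
    proof (rule divide_left_mono)
      have "a * a * a \<le> a * b * (a + b)" using 4 by (intro mult_mono) auto
      then show "a^3 \<le> a * b * (a + b)" by (simp add: power3_eq_cube)
    qed (use pos d R in auto)
    finally show ?thesis using k by simp
  qed
qed

lemma abs_dist_diff_le: "\<bar>dist x y - dist x' y\<bar> \<le> dist x (x'::'a::metric_space)"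
  using dist_triangle[of x y x'] dist_triangle[of x' y x] by (simp add: dist_commute)

section \<open>Estimates for the potential of a tame density\<close>

context tame_density begin

lemma borel_measurable_density [measurable]: "w \<in> borel_measurable lebesgue"
  using integrable by auto

lemma integral_nonneg: "0 \<le> (\<integral>y. w y \<partial>lebesgue)"
  using nonneg by simp

lemma integrable_newton: "integrable lebesgue (\<lambda>y. w y / dist x y)"
  and newton_potential_le: "newton_potential w x \<le> (\<integral>y. w y \<partial>lebesgue) + L"
proof -
  have le: "AE y in lebesgue. 0 \<le> w y / dist x y \<and> w y / dist x y \<le> w y + w y / (dist x y)\<^sup>2"
    using mult_left_mono[OF inverse_le_one_plus_inverse_sq nonneg, of "dist x _"] nonneg
    by (intro AE_I2) (simp add: algebra_simps)
  note A = integrable_nonneg_le_AE[OF Bochner_Integration.integrable_add[OF integrable integrable_sq] _ le]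
  show "integrable lebesgue (\<lambda>y. w y / dist x y)" by (rule A) measurable
  have "newton_potential w x \<le> (\<integral>y. w y + w y / (dist x y)\<^sup>2 \<partial>lebesgue)"
    unfolding newton_potential_def by (rule A) measurable
  also have "\<dots> \<le> (\<integral>y. w y \<partial>lebesgue) + L"
    using integral_sq_le[of x] by (simp add: integrable integrable_sq)
  finally show "newton_potential w x \<le> (\<integral>y. w y \<partial>lebesgue) + L" .
qed

lemma newton_potential_nonneg: "newton_potential w x \<ge> 0"
  unfolding newton_potential_def using nonneg by simp

text \<open>Exchanging \<open>x\<close> and \<open>x'\<close> turns this into the Lipschitz
  bound.\<close>

lemma newton_potential_diff_le: "newton_potential w x - newton_potential w x' \<le> L * dist x x'"
proof -
  have "newton_potential w x - newton_potential w x' = (\<integral>y. w y / dist x y - w y / dist x' y \<partial>lebesgue)"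
    unfolding newton_potential_def by (simp add: integrable_newton)
  also have "\<dots> \<le> (\<integral>y. dist x x' * (w y / (dist x y)\<^sup>2) \<partial>lebesgue)"
  proof (rule integral_mono)
    fix y
    show "w y / dist x y - w y / dist x' y \<le> dist x x' * (w y / (dist x y)\<^sup>2)"
      using mult_left_mono[OF inverse_diff_le[OF _ _ abs_dist_diff_le[of x y x']] nonneg[of y]]
      by (simp add: algebra_simps)
  qed (intro integrable_newton integrable_sq Bochner_Integration.integrable_diff integrable_mult_right)+
  also have "\<dots> = dist x x' * (\<integral>y. w y / (dist x y)\<^sup>2 \<partial>lebesgue)"
    by (rule integral_mult_right_zero)
  also have "\<dots> \<le> dist x x' * L"
    using integral_sq_le[of x] by (intro mult_left_mono) auto
  finally show ?thesis by (simp add: mult.commute)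
qed

text \<open>A sharper bound than the Lipschitz one: confinement to the cylinder allows
  \<open>w\<close> to be replaced by \<open>S\<close> and the kernel difference by
  \<open>d * cyl_kernel R\<close>, whose integral contributes the extra factor
  \<open>R\<close>.\<close>

lemma newton_potential_cylinder_diff_le:
  assumes S: "AE y in lebesgue. w y \<le> S"
    and supp: "AE y in lebesgue. w y \<noteq> 0 \<longrightarrow> rad y \<le> R"
    and R: "R > 0" and "d = dist x x'" "d \<le> R"
    and closer: "\<And>y. rad y \<le> R \<Longrightarrow> (dist x' y)\<^sup>2 - (dist x y)\<^sup>2 \<le> 4 * R * d"
    and C: "integrable lebesgue (\<lambda>y. indicator {y. rad y \<le> R} y * cyl_kernel R (dist x y))"
      "integral\<^sup>L lebesgue (\<lambda>y. indicator {y. rad y \<le> R} y * cyl_kernel R (dist x y)) \<le> C * R"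
    and "S \<ge> 0"
  shows "newton_potential w x - newton_potential w x' \<le> C * S * R * d"
proof -
  let ?k = "\<lambda>y. indicator {y. rad y \<le> R} y * cyl_kernel R (dist x y)"
  have d: "d \<ge> 0" using assms by simp
  have "newton_potential w x - newton_potential w x' = (\<integral>y. w y / dist x y - w y / dist x' y \<partial>lebesgue)"
    unfolding newton_potential_def by (simp add: integrable_newton)
  also have "\<dots> \<le> (\<integral>y. S * d * ?k y \<partial>lebesgue)"
  proof (rule integral_mono_AE)
    show "AE y in lebesgue. w y / dist x y - w y / dist x' y \<le> S * d * ?k y"
      using S supp
    proof eventually_elim
      case (elim y)
      show ?case
      proof (cases "w y = 0")
        case True
        then show ?thesis using \<open>S \<ge> 0\<close> d R cyl_kernel_nonneg[of R "dist x y"] by simp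
      next
        case False
        then have y: "rad y \<le> R" using elim by simp
        have "w y * (1 / dist x y - 1 / dist x' y) \<le> w y * (d * cyl_kernel R (dist x y))"
          using abs_dist_diff_le[of x y x'] assms(4,5) closer[OF y] nonneg
          by (intro mult_left_mono inverse_diff_le_cyl_kernel) auto
        also have "\<dots> \<le> S * (d * cyl_kernel R (dist x y))"
          using elim d R cyl_kernel_nonneg[of R "dist x y"] by (intro mult_right_mono) auto
        finally show ?thesis using y by (simp add: algebra_simps)
      qed
    qed
  qed (use integrable_newton C(1) in auto)
  also have "\<dots> = S * d * integral\<^sup>L lebesgue ?k" by (rule integral_mult_right_zero)
  also have "\<dots> \<le> S * d * (C * R)"
    using C(2) \<open>S \<ge> 0\<close> d by (intro mult_left_mono) auto
  finally show ?thesis by (simp add: algebra_simps)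
qed

lemma integral_le_of_cylinder_segment:
  assumes S: "AE y in lebesgue. w y \<le> S" "S \<ge> 0"
    and supp: "AE y in lebesgue. w y \<noteq> 0 \<longrightarrow> rad y \<le> R \<and> norm y \<le> Z" and "R \<ge> 0" "Z \<ge> 0"
  shows "(\<integral>y. w y \<partial>lebesgue) \<le> S * (8 * R\<^sup>2 * Z)"
proof -
  define A where "A = {y::real^3. rad y \<le> R \<and> \<bar>y$3 - 0\<bar> \<le> Z}"
  have "A \<in> sets borel" unfolding A_def by measurable
  then have Am: "A \<in> sets lebesgue" by simp
  have em: "emeasure lebesgue A \<le> ennreal (8 * R\<^sup>2 * Z)"
    unfolding A_def by (rule emeasure_cylinder_segment_le) (use assms in auto)
  then have fin: "emeasure lebesgue A < \<infinity>" using ennreal_less_top le_less_trans by fastforce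
  have "(\<integral>y. w y \<partial>lebesgue) \<le> (\<integral>y. S * indicator A y \<partial>lebesgue)"
  proof (rule integral_mono_AE)
    show "AE y in lebesgue. w y \<le> S * indicator A y"
      using S(1) supp
    proof eventually_elim
      case (elim y)
      then show ?case using component_le_norm_cart[of y 3] S(2)
        by (cases "w y = 0") (auto simp: A_def)
    qed
  qed (use integrable Am fin in auto)
  also have "\<dots> = S * measure lebesgue A" using Am fin by simp
  also have "measure lebesgue A \<le> 8 * R\<^sup>2 * Z"
    using em assms by (simp add: measure_def enn2real_leI)
  finally show ?thesis using S(2) by (simp add: mult_left_mono)
qed

text \<open>Three zones: within distance \<open>a\<close> the Riesz bound with exponent 1 applies;
  between \<open>a\<close> and \<open>T\<close> the kernel is at most \<open>1 / a\<close> on a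
  cylinder segment of small volume; beyond \<open>T\<close> it is at most \<open>1 / T\<close>
  against the total mass. Choosing \<open>a\<close> small, \<open>T\<close> large and then
  \<open>R\<close> small makes everything small.\<close>

lemma newton_potential_thin_cylinder_le:
  assumes S: "AE y in lebesgue. w y \<le> S" "S \<ge> 0"
    and supp: "AE y in lebesgue. w y \<noteq> 0 \<longrightarrow> rad y \<le> R" and "R \<ge> 0" "a > 0" "T > 0"
    and C: "integrable lebesgue (\<lambda>y. indicator (ball x a) y * dist x y powr (-1))"
      "integral\<^sup>L lebesgue (\<lambda>y. indicator (ball x a) y * dist x y powr (-1)) \<le> C * a powr (3-1)"
  shows "newton_potential w x \<le> C * S * a\<^sup>2 + S * (8 * R\<^sup>2 * T) / a + (\<integral>y. w y \<partial>lebesgue) / T"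
proof -
  define A where "A = {y::real^3. rad y \<le> R \<and> \<bar>y$3 - x$3\<bar> \<le> T}"
  have "A \<in> sets borel" unfolding A_def by measurable
  then have Am: "A \<in> sets lebesgue" by simp
  have em: "emeasure lebesgue A \<le> ennreal (8 * R\<^sup>2 * T)"
    unfolding A_def by (rule emeasure_cylinder_segment_le) (use assms in auto)
  then have fin: "emeasure lebesgue A < \<infinity>" using ennreal_less_top le_less_trans by fastforce
  define h where "h = (\<lambda>y. S * (indicator (ball x a) y * dist x y powr (-1)) + S / a * indicator A y + w y / T)"
  have hi: "integrable lebesgue h"
    unfolding h_def using Am fin integrable
    by (intro Bochner_Integration.integrable_add integrable_mult_right[OF C(1)]) auto
  have "newton_potential w x \<le> integral\<^sup>L lebesgue h"
    unfolding newton_potential_def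
  proof (rule integral_mono_AE[OF integrable_newton hi])
    show "AE y in lebesgue. w y / dist x y \<le> h y"
      using S(1) supp
    proof eventually_elim
      case (elim y)
      have p: "S * (indicator (ball x a) y * dist x y powr (-1)) \<ge> 0" "S / a * indicator A y \<ge> 0" "w y / T \<ge> 0"
        using assms nonneg by auto
      consider "w y = 0" | "w y \<noteq> 0" "dist x y < a" | "w y \<noteq> 0" "a \<le> dist x y" "dist x y < T" | "T \<le> dist x y"
        by linarith
      then show ?case
      proof cases
        case 1 then show ?thesis using p by (simp add: h_def)
      next
        case 2
        have "w y / dist x y \<le> S / dist x y" using elim by (intro divide_right_mono) auto
        also have "\<dots> = S * (indicator (ball x a) y * dist x y powr (-1))"
          using 2 by (simp add: powr_minus_divide)
        finally show ?thesis using p by (simp add: h_def)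
      next
        case 3
        have "\<bar>y$3 - x$3\<bar> \<le> dist x y"
          using component_le_norm_cart[of "x - y" 3] by (simp add: dist_norm abs_minus_commute)
        then have "y \<in> A" using 3 elim by (simp add: A_def)
        moreover have "w y / dist x y \<le> S / a"
          using elim 3 assms nonneg[of y] by (intro frac_le) auto
        ultimately show ?thesis using p by (simp add: h_def)
      next
        case 4
        then have "dist x y > 0" using \<open>T > 0\<close> by linarith
        then have "w y / dist x y \<le> w y / T"
          using 4 \<open>T > 0\<close> nonneg[of y] by (intro divide_left_mono mult_pos_pos) auto
        then show ?thesis using p by (simp add: h_def)
      qed
    qed
  qed
  also have "\<dots> = S * integral\<^sup>L lebesgue (\<lambda>y. indicator (ball x a) y * dist x y powr (-1))
      + S / a * measure lebesgue A + (\<integral>y. w y \<partial>lebesgue) / T"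
  proof -
    define k where "k = (\<lambda>y. indicator (ball x a) y * dist x y powr (-1))"
    have "integrable lebesgue k" using C(1) by (simp only: k_def)
    moreover have "h = (\<lambda>y. S * k y + S / a * indicator A y + w y / T)" by (simp only: h_def k_def)
    ultimately have "integral\<^sup>L lebesgue h
        = S * integral\<^sup>L lebesgue k + S / a * measure lebesgue A + (\<integral>y. w y \<partial>lebesgue) / T"
      using Am fin integrable by simp
    then show ?thesis by (simp only: k_def)
  qed
  also have "\<dots> \<le> S * (C * a\<^sup>2) + S / a * (8 * R\<^sup>2 * T) + (\<integral>y. w y \<partial>lebesgue) / T"
  proof (intro add_mono mult_left_mono order_refl)
    show "integral\<^sup>L lebesgue (\<lambda>y. indicator (ball x a) y * dist x y powr (-1)) \<le> C * a\<^sup>2"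
      using C(2) \<open>a > 0\<close> by simp
    show "measure lebesgue A \<le> 8 * R\<^sup>2 * T"
      using em assms by (simp add: measure_def enn2real_leI)
  qed (use assms in auto)
  finally show ?thesis by (simp add: algebra_simps)
qed

end

section \<open>Bounded densities, and \<open>L^q\<close> densities of bounded support\<close>

lemma bounded_density_kernel_bound:
  fixes w :: "real^3 \<Rightarrow> real"
  assumes w: "\<And>y. w y \<ge> 0" "integrable lebesgue w" "AE y in lebesgue. w y \<le> S"
    and "a > 0" "s > 0"
    and C: "integrable lebesgue (\<lambda>y. indicator (ball x a) y * dist x y powr (-s))"
      "integral\<^sup>L lebesgue (\<lambda>y. indicator (ball x a) y * dist x y powr (-s)) \<le> C * a powr (3-s)"
    and "S \<ge> 0"
  shows "integrable lebesgue (\<lambda>y. w y * dist x y powr (-s))"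
    and "(\<integral>y. w y * dist x y powr (-s) \<partial>lebesgue) \<le> C * S * a powr (3-s) + a powr (-s) * (\<integral>y. w y \<partial>lebesgue)"
proof -
  let ?k = "\<lambda>y. indicator (ball x a) y * dist x y powr (-s)"
  let ?h = "\<lambda>y. S * ?k y + a powr (-s) * w y"
  have hi: "integrable lebesgue ?h" using C(1) w(2) by auto
  have m: "(\<lambda>y. w y * dist x y powr (-s)) \<in> borel_measurable lebesgue"
    using w(2) by measurable
  have le: "AE y in lebesgue. 0 \<le> w y * dist x y powr (-s) \<and> w y * dist x y powr (-s) \<le> ?h y"
    using w(3)
  proof eventually_elim
    case (elim y)
    have p: "S * ?k y \<ge> 0" "a powr (-s) * w y \<ge> 0" using assms by auto
    show ?case
    proof (cases "dist x y < a")
      case True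
      then have "w y * dist x y powr (-s) \<le> S * ?k y" using elim by (simp add: mult_right_mono)
      moreover have "0 \<le> w y * dist x y powr (-s)" using w(1)[of y] by simp
      ultimately show ?thesis using p by linarith
    next
      case False
      then have "dist x y powr (-s) \<le> a powr (-s)" using assms by (intro powr_mono2') auto
      then have "w y * dist x y powr (-s) \<le> a powr (-s) * w y" using w(1)[of y]
        by (metis mult.commute mult_right_mono)
      moreover have "0 \<le> w y * dist x y powr (-s)" using w(1)[of y] by simp
      ultimately show ?thesis using p by linarith
    qed
  qed
  note A = integrable_nonneg_le_AE[OF hi m le]
  show "integrable lebesgue (\<lambda>y. w y * dist x y powr (-s))" by (rule A)
  have "(\<integral>y. w y * dist x y powr (-s) \<partial>lebesgue) \<le> integral\<^sup>L lebesgue ?h" by (rule A)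
  also have "\<dots> = S * integral\<^sup>L lebesgue ?k + a powr (-s) * (\<integral>y. w y \<partial>lebesgue)"
    using C(1) w(2) by simp
  also have "\<dots> \<le> S * (C * a powr (3-s)) + a powr (-s) * (\<integral>y. w y \<partial>lebesgue)"
    using C(2) \<open>S \<ge> 0\<close> by (intro add_mono mult_left_mono) auto
  finally show "(\<integral>y. w y * dist x y powr (-s) \<partial>lebesgue) \<le> C * S * a powr (3-s) + a powr (-s) * (\<integral>y. w y \<partial>lebesgue)"
    by (simp add: algebra_simps)
qed

text \<open>Young's inequality with constants 1: either \<open>b\<close> is at most
  \<open>a powr (q - 1)\<close> and the first term suffices, or \<open>a\<close> is at most
  \<open>b powr (1/(q-1))\<close> and the second one does.\<close>

lemma mult_powr_young:
  fixes a b q :: real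
  assumes "a \<ge> 0" "b \<ge> 0" "q > 1"
  shows "a * b \<le> a powr q + b powr (q / (q - 1))"
proof (cases "b \<le> a powr (q - 1)")
  case True
  then have "a * b \<le> a * a powr (q - 1)" using assms by (intro mult_left_mono)
  also have "\<dots> = a powr q" using assms by (cases "a = 0") (simp_all add: powr_mult_base)
  finally show ?thesis by (simp add: add_increasing2)
next
  case False
  then have b: "b > 0" using assms by (meson less_le_trans not_le powr_ge_zero le_less_trans)
  have "a = (a powr (q-1)) powr (1/(q-1))" using assms by (simp add: powr_powr)
  also have "\<dots> \<le> b powr (1/(q-1))" using False assms by (intro powr_mono2) auto
  finally have "a * b \<le> b powr (1/(q-1)) * b powr 1" using b by simp
  also have "\<dots> = b powr (1/(q-1) + 1)" by (simp add: powr_add)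
  also have "1/(q-1) + 1 = q/(q-1)" using assms by (simp add: field_simps)
  finally show ?thesis by (simp add: add_increasing)
qed

text \<open>The condition \<open>q > 3\<close> says that the conjugate exponent \<open>q'\<close> is
  below 3/2. Then the inverse square to the power \<open>q'\<close> is still locally integrable, and
  Young's inequality separates it from \<open>w\<close> inside the unit ball around
  \<open>x\<close>.\<close>

lemma Lq_density_tame:
  fixes w :: "real^3 \<Rightarrow> real"
  assumes "\<And>y. w y \<ge> 0" and [measurable]: "w \<in> borel_measurable lebesgue"
    and supp: "\<And>y. y \<notin> K \<Longrightarrow> w y = 0" and K: "bounded K"
    and q: "q > 3" "integrable lebesgue (\<lambda>y. w y powr q)"
  obtains L where "tame_density w L"
proof -
  define q' where "q' = q / (q - 1)"
  have q': "0 < 2 * q'" "2 * q' < 3" using q by (auto simp: q'_def field_simps)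
  obtain D where D: "K \<subseteq> ball 0 D" "D > 0" using K bounded_subset_ballD by blast
  have Bm: "integrable lebesgue (indicator (ball 0 D) :: real^3 \<Rightarrow> real)"
    using emeasure_ball_real3[of D 0] D(2) by simp
  obtain C where C: "C \<ge> 0"
    "\<And>(x::real^3) a. a > 0 \<Longrightarrow> integrable lebesgue (\<lambda>y. indicator (ball x a) y * dist x y powr (-(2*q')))"
    "\<And>(x::real^3) a. a > 0 \<Longrightarrow>
       integral\<^sup>L lebesgue (\<lambda>y. indicator (ball x a) y * dist x y powr (-(2*q'))) \<le> C * a powr (3-(2*q'))"
    using riesz_kernel_near_bound[OF q'] by blast
  have w_le: "w y \<le> w y powr q + indicator (ball 0 D) y" for y
  proof (cases "y \<in> K")
    case True
    then show ?thesis using mult_powr_young[of "w y" 1 q] assms(1)[of y] q(1) D(1) by auto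
  qed (simp add: supp)
  have "integrable lebesgue w"
    by (rule integrable_nonneg_le_AE[OF Bochner_Integration.integrable_add[OF q(2) Bm]])
      (use assms(1) w_le in auto)
  moreover have "integrable lebesgue (\<lambda>y. w y / (dist x y)\<^sup>2)
     \<and> (\<integral>y. w y / (dist x y)\<^sup>2 \<partial>lebesgue) \<le> 2 * (\<integral>y. w y powr q \<partial>lebesgue) + measure lebesgue (ball (0::real^3) D) + C" for x
  proof -
    let ?k = "\<lambda>y. indicator (ball x 1) y * dist x y powr (-(2*q'))"
    let ?h = "\<lambda>y. (2 * w y powr q + indicator (ball 0 D) y) + ?k y"
    have hi: "integrable lebesgue ?h" using q(2) Bm C(2)[of 1 x]
      by (intro Bochner_Integration.integrable_add) auto
    have m: "(\<lambda>y. w y / (dist x y)\<^sup>2) \<in> borel_measurable lebesgue" by measurable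
    have le: "w y / (dist x y)\<^sup>2 \<le> ?h y" for y
    proof (cases "dist x y < 1")
      case True
      have "w y * (dist x y powr (-2)) \<le> w y powr q + (dist x y powr (-2)) powr q'"
        unfolding q'_def using assms(1) q(1) by (intro mult_powr_young) auto
      also have "(dist x y powr (-2)) powr q' = ?k y" using True by (simp add: powr_powr)
      also have "w y * (dist x y powr (-2)) = w y / (dist x y)\<^sup>2" by (simp add: powr_minus_divide)
      finally have 1: "w y / (dist x y)\<^sup>2 \<le> w y powr q + ?k y" .
      have "0 \<le> w y powr q + indicator (ball 0 D) y" by (simp add: add_nonneg_nonneg)
      with 1 show ?thesis by linarith
    next
      case False
      then have "w y / (dist x y)\<^sup>2 \<le> w y / 1"
        using assms(1) by (intro divide_left_mono) (auto simp: one_le_power)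
      moreover have "0 \<le> w y powr q + ?k y" by (simp add: add_nonneg_nonneg)
      ultimately show ?thesis using w_le[of y] by linarith
    qed
    have le': "AE y in lebesgue. 0 \<le> w y / (dist x y)\<^sup>2 \<and> w y / (dist x y)\<^sup>2 \<le> ?h y"
      using le assms(1) by (intro AE_I2) auto
    note A = integrable_nonneg_le_AE[OF hi m le']
    have "integral\<^sup>L lebesgue ?h = 2 * (\<integral>y. w y powr q \<partial>lebesgue) + measure lebesgue (ball (0::real^3) D) + integral\<^sup>L lebesgue ?k"
      using q(2) Bm C(2)[of 1 x] by simp
    then show ?thesis using A C(3)[of 1 x] by simp
  qed
  ultimately show thesis
    by (intro that[of "2 * (\<integral>y. w y powr q \<partial>lebesgue) + measure lebesgue (ball (0::real^3) D) + C"])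
      (unfold_locales, use assms(1) in auto)
qed

lemma bounded_density_tame:
  fixes w :: "real^3 \<Rightarrow> real"
  assumes w: "\<And>y. w y \<ge> 0" "integrable lebesgue w" "AE y in lebesgue. w y \<le> S" and S: "S \<ge> 0"
    and C: "\<And>x::real^3. integrable lebesgue (\<lambda>y. indicator (ball x 1) y * dist x y powr (-2))"
      "\<And>x::real^3. integral\<^sup>L lebesgue (\<lambda>y. indicator (ball x 1) y * dist x y powr (-2)) \<le> C"
  shows "tame_density w (C * S + (\<integral>y. w y \<partial>lebesgue))"
proof
  fix x :: "real^3"
  have C': "integral\<^sup>L lebesgue (\<lambda>y. indicator (ball x 1) y * dist x y powr (-2)) \<le> C * 1 powr (3 - 2)"
    using C(2)[of x] by (simp only: powr_one_eq_one mult_1_right)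
  have eq: "w y * dist x y powr (-2) = w y / (dist x y)\<^sup>2" for y
    by (simp add: powr_minus_divide)
  note A = bounded_density_kernel_bound[OF w zero_less_one zero_less_numeral C(1) C' S, unfolded eq]
  show "integrable lebesgue (\<lambda>y. w y / (dist x y)\<^sup>2)" by (rule A)
  show "(\<integral>y. w y / (dist x y)\<^sup>2 \<partial>lebesgue) \<le> C * S + (\<integral>y. w y \<partial>lebesgue)"
    using A(2) by simp
qed (use w in auto)

lemma bounded_density_potential_le:
  fixes w :: "real^3 \<Rightarrow> real"
  assumes w: "\<And>y. w y \<ge> 0" "integrable lebesgue w" "AE y in lebesgue. w y \<le> S" and S: "S > 0"
    and C: "\<And>(x::real^3) a. a > 0 \<Longrightarrow> integrable lebesgue (\<lambda>y. indicator (ball x a) y * dist x y powr (-1))"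
      "\<And>(x::real^3) a. a > 0 \<Longrightarrow>
         integral\<^sup>L lebesgue (\<lambda>y. indicator (ball x a) y * dist x y powr (-1)) \<le> C * a powr (3-1)"
  shows "newton_potential w x \<le> (C + (\<integral>y. w y \<partial>lebesgue)) * S powr (1/3)"
proof -
  \<comment> \<open>This radius balances the near part \<open>S * a\<^sup>2\<close> against the far
    part \<open>1 / a\<close>. Both become \<open>S powr (1/3)\<close>, the growth that (F2) lets
    \<open>A'\<close> beat at infinity.\<close>
  define a where "a = S powr (-1/3)"
  have a: "a > 0" using S by (simp add: a_def)
  have "newton_potential w x = (\<integral>y. w y * dist x y powr (-1) \<partial>lebesgue)"
    unfolding newton_potential_def by (simp add: powr_minus_divide)
  also have "\<dots> \<le> C * S * a powr (3-1) + a powr (-1) * (\<integral>y. w y \<partial>lebesgue)"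
    by (rule bounded_density_kernel_bound(2)[OF w a zero_less_one C[OF a]]) (use S in auto)
  also have "C * S * a powr (3-1) = C * S powr (1/3)"
  proof -
    have "S * a powr (3-1) = S powr 1 * S powr (-2/3)" using S by (simp add: a_def powr_powr del: powr_numeral)
    also have "\<dots> = S powr (1/3)" by (simp only: powr_add[symmetric]) simp
    finally show ?thesis by simp
  qed
  also have "a powr (-1) = S powr (1/3)" by (simp only: a_def powr_powr) simp
  finally show ?thesis by (simp add: algebra_simps)
qed

text \<open>Passes from the gauge integrals in \<open>Bop\<close> and \<open>PhiK\<close> to
  Lebesgue integrals; tameness supplies the absolute integrability.\<close>

lemma integral_eq_newton_potential:
  assumes "tame_density (\<lambda>y. indicator A y * h y) L"
  shows "integral A (\<lambda>y. h y / dist x y) = newton_potential (\<lambda>y. indicator A y * h y) x"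
proof -
  interpret tame_density "\<lambda>y. indicator A y * h y" L by fact
  have "set_integrable lebesgue A (\<lambda>y. h y / dist x y)"
    using integrable_newton[of x] by (simp add: set_integrable_def)
  from set_lebesgue_integral_eq_integral(2)[OF this] show ?thesis
    by (simp add: set_lebesgue_integral_def newton_potential_def)
qed

section \<open>Outward rays and the half-turn symmetry\<close>

lemma rot3_pi: "rot3 pi y = vector [- y$1, - y$2, y$3]"
  by (simp add: rot3_def)

text \<open>The half-turn is the diagonal map with entries -1, -1, 1, so the change of variables for
  coordinatewise scalings applies with Jacobian 1.\<close>

lemma lebesgue_rot3_pi:
  shows "rot3 pi \<in> lebesgue \<rightarrow>\<^sub>M lebesgue" and "distr lebesgue lebesgue (rot3 pi) = lebesgue"
proof -
  define c :: "real^3 \<Rightarrow> real" where "c = (\<lambda>j. if j = axis 3 1 then 1 else -1)"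
  define T :: "real^3 \<Rightarrow> real^3" where "T = (\<lambda>x. 0 + (\<Sum>j\<in>Basis. (c j * (x \<bullet> j)) *\<^sub>R j))"
  have T: "T = rot3 pi"
  proof
    fix x
    show "T x = rot3 pi x"
    proof (rule euclidean_eqI)
      fix b :: "real^3" assume b: "b \<in> Basis"
      then obtain i where i: "b = axis i 1" by (auto simp: Basis_vec_def)
      have "T x \<bullet> b = c b * (x \<bullet> b)" using b by (simp add: T_def)
      also have "\<dots> = rot3 pi x \<bullet> b"
        using exhaust_3[of i] by (auto simp: i c_def rot3_pi inner_axis axis_eq_axis)
      finally show "T x \<bullet> b = rot3 pi x \<bullet> b" .
    qed
  qed
  have cn: "\<And>j. j \<in> Basis \<Longrightarrow> c j \<noteq> 0" by (simp add: c_def)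
  have cp: "(\<Prod>j\<in>Basis. \<bar>c j\<bar>) = 1" by (rule prod.neutral) (simp add: c_def)
  show m: "rot3 pi \<in> lebesgue \<rightarrow>\<^sub>M lebesgue"
    using lebesgue_affine_measurable[OF cn, of "\<lambda>j. j" 0] unfolding T[symmetric] T_def by simp
  have "lebesgue = density (distr lebesgue lebesgue T) (\<lambda>_. (\<Prod>j\<in>Basis. \<bar>c j\<bar>))"
    unfolding T_def by (rule lebesgue_affine_euclidean[OF cn])
  then show "distr lebesgue lebesgue (rot3 pi) = lebesgue"
    unfolding cp T by (simp add: density_1)
qed

lemma integral_rot3_pi:
  fixes h :: "real^3 \<Rightarrow> real"
  assumes "h \<in> borel_measurable lebesgue"
  shows "(\<integral>y. h (rot3 pi y) \<partial>lebesgue) = (\<integral>y. h y \<partial>lebesgue)"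
  using integral_distr[OF lebesgue_rot3_pi(1) assms] by (simp add: lebesgue_rot3_pi(2))

lemma dist_rot3_pi: "dist (rot3 pi x) y = dist x (rot3 pi y)"
  by (simp add: rot3_pi dist_vec_def L2_set_def sum_3 dist_real_def power2_commute)
    (simp add: power2_eq_square algebra_simps)

lemma dist_sq_real3: "(dist (x::real^3) y)\<^sup>2 = (x$1 - y$1)\<^sup>2 + (x$2 - y$2)\<^sup>2 + (x$3 - y$3)\<^sup>2"
  by (simp add: dist_vec_def L2_set_def sum_3 dist_real_def)

section \<open>Convexity and slope of the inverse square root\<close>

lemma convex_on_inverse_sqrt: "convex_on {0<..} (\<lambda>u::real. 1 / sqrt u)"
proof -
  have conv: "convex_on {0<..} (\<lambda>u::real. u powr (-1/2))"
  proof (rule f''_ge0_imp_convex)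
    fix u :: real assume u: "u \<in> {0<..}"
    show "((\<lambda>u. u powr (-1/2)) has_real_derivative (-1/2) * u powr (-1/2 - 1)) (at u)"
      using u by (auto intro!: derivative_eq_intros)
    show "((\<lambda>u. (-1/2) * u powr (-1/2 - 1)) has_real_derivative (-1/2) * ((-1/2 - 1) * u powr (-1/2 - 1 - 1))) (at u)"
      using u by (auto intro!: derivative_eq_intros)
    show "0 \<le> (-1/2) * ((-1/2 - 1) * u powr (-1/2 - 1 - 1))" by simp
  qed auto
  have eq: "u powr (-1/2) = 1 / sqrt u" if "u > 0" for u :: real
    using that by (simp add: powr_minus_divide powr_half_sqrt[symmetric])
  show ?thesis
  proof (rule convex_onI)
    fix t x y :: real
    assume t: "0 < t" "t < 1" and xy: "x \<in> {0<..}" "y \<in> {0<..}"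
    then have "(1 - t) *\<^sub>R x + t *\<^sub>R y > 0" by (simp add: add_pos_pos)
    then show "1 / sqrt ((1 - t) *\<^sub>R x + t *\<^sub>R y) \<le> (1 - t) * (1 / sqrt x) + t * (1 / sqrt y)"
      using convex_onD[OF conv, of t x y] t xy by (simp only: eq greaterThan_iff less_imp_le)
  qed simp
qed

text \<open>Both \<open>A - w\<close> and \<open>A + w\<close> are convex combinations of
  \<open>A - w'\<close> and \<open>A + w'\<close>, with the weights \<open>(1 + \<tau>) / 2\<close>
  and \<open>(1 - \<tau>) / 2\<close> exchanged. In the sum of the two convexity inequalities the
  weights add up to 1.\<close>

lemma symmetric_inverse_sqrt_mono:
  fixes A w w' \<tau> :: real
  assumes "w = \<tau> * w'" "0 \<le> \<tau>" "\<tau> \<le> 1" "A - w' > 0" "A + w' > 0"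
  shows "1 / sqrt (A - w) + 1 / sqrt (A + w) \<le> 1 / sqrt (A - w') + 1 / sqrt (A + w')"
proof -
  let ?p = "\<lambda>u::real. 1 / sqrt u" and ?s = "(1 - \<tau>) / 2"
  define P Q where "P = ?p (A - w')" and "Q = ?p (A + w')"
  have "(1 - ?s) *\<^sub>R (A - w') + ?s *\<^sub>R (A + w') = A - w"
    "(1 - ?s) *\<^sub>R (A + w') + ?s *\<^sub>R (A - w') = A + w"
    using assms(1) by (simp_all add: field_simps)
  moreover have "?p ((1 - ?s) *\<^sub>R (A - w') + ?s *\<^sub>R (A + w')) \<le> (1 - ?s) * P + ?s * Q"
    unfolding P_def Q_def by (rule convex_onD[OF convex_on_inverse_sqrt]) (use assms in auto)
  moreover have "?p ((1 - ?s) *\<^sub>R (A + w') + ?s *\<^sub>R (A - w')) \<le> (1 - ?s) * Q + ?s * P"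
    unfolding P_def Q_def by (rule convex_onD[OF convex_on_inverse_sqrt]) (use assms in auto)
  ultimately have "?p (A - w) + ?p (A + w) \<le> ((1 - ?s) * P + ?s * Q) + ((1 - ?s) * Q + ?s * P)"
    by (intro add_mono) simp_all
  also have "\<dots> = P + Q" by (simp add: field_simps)
  finally show ?thesis by (simp only: P_def Q_def)
qed

lemma inverse_sqrt_diff_le:
  fixes u v :: real
  assumes "1 \<le> u" "u \<le> v"
  shows "1 / sqrt u - 1 / sqrt v \<le> (v - u) / 2"
proof -
  have s: "1 \<le> sqrt u" "sqrt u \<le> sqrt v" using assms by auto
  have "1 / sqrt u - 1 / sqrt v = (sqrt v - sqrt u) / (sqrt u * sqrt v)"
    using assms s by (simp add: field_simps)
  also have "\<dots> \<le> (sqrt v - sqrt u) / 1"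
    using s mult_mono[of 1 "sqrt u" 1 "sqrt v"] by (intro divide_left_mono) auto
  also have "\<dots> \<le> (sqrt v - sqrt u) * ((sqrt v + sqrt u) / 2)"
  proof -
    have "1 \<le> (b + a) / 2 \<and> 0 \<le> b - a" if "1 \<le> a" "a \<le> b" for a b :: real
      using that by auto
    from this[OF s] show ?thesis using mult_left_mono[of 1 "(sqrt v + sqrt u)/2" "sqrt v - sqrt u"] by simp
  qed
  also have "\<dots> = (v - u) / 2"
  proof -
    have "(sqrt v - sqrt u) * (sqrt v + sqrt u) = (sqrt v)\<^sup>2 - (sqrt u)\<^sup>2"
      by (simp add: power2_eq_square algebra_simps)
    then show ?thesis using assms by simp
  qed
  finally show ?thesis .
qed

text \<open>The half line of \<open>no_trapping\<close>, parametrised so that the distance to the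
  axis is multiplied by \<open>1 + t\<close>. Points on the axis do not move, whence the conditions
  \<open>rad p > 0\<close> below.\<close>

definition push_out :: "real \<Rightarrow> real^3 \<Rightarrow> real^3" where
  "push_out t p = p + t *\<^sub>R vector [p$1, p$2, 0]"

lemma push_out_nth [simp]:
  "push_out t p $ 1 = (1 + t) * p$1" "push_out t p $ 2 = (1 + t) * p$2" "push_out t p $ 3 = p$3"
  by (simp_all add: push_out_def algebra_simps)

lemma rad_sq: "(rad x)\<^sup>2 = (x$1)\<^sup>2 + (x$2)\<^sup>2"
  by (simp add: rad_def)

lemma rad_push_out:
  assumes "t \<ge> 0" shows "rad (push_out t p) = (1 + t) * rad p"
proof -
  have "rad (push_out t p) = sqrt ((1 + t)\<^sup>2 * ((p$1)\<^sup>2 + (p$2)\<^sup>2))"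
    by (simp add: rad_def power_mult_distrib distrib_left)
  then show ?thesis using assms by (simp add: rad_def real_sqrt_mult)
qed

lemma dist_push_out:
  assumes "t \<ge> 0" shows "dist p (push_out t p) = t * rad p"
proof -
  have "(dist p (push_out t p))\<^sup>2 = (t * rad p)\<^sup>2"
    unfolding dist_sq_real3 power_mult_distrib rad_sq
    by (simp add: power2_eq_square algebra_simps)
  then show ?thesis using assms by (simp add: power2_eq_iff_nonneg)
qed

text \<open>Cauchy-Schwarz for the horizontal components bounds the cross term. If all three radii
  are at most \<open>R\<close>, the factor in front of the displacement \<open>t * rad p\<close> is
  at most \<open>4 * R\<close>.\<close>

lemma dist_sq_push_out_diff_le:
  assumes "t \<ge> 0"
  shows "(dist (push_out t p) y)\<^sup>2 - (dist p y)\<^sup>2 \<le> (rad p + rad (push_out t p) + 2 * rad y) * (t * rad p)"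
proof -
  have "(p$1 * y$1 + p$2 * y$2)\<^sup>2 \<le> (rad p * rad y)\<^sup>2"
    unfolding power_mult_distrib rad_sq
    using zero_le_power2[of "p$1 * y$2 - p$2 * y$1"] by (simp add: power2_eq_square algebra_simps)
  then have "\<bar>p$1 * y$1 + p$2 * y$2\<bar> \<le> rad p * rad y"
    using abs_le_square_iff[of "p$1 * y$1 + p$2 * y$2" "rad p * rad y"] by simp
  then have cs: "- (p$1 * y$1 + p$2 * y$2) \<le> rad p * rad y" by linarith
  have "(dist (push_out t p) y)\<^sup>2 - (dist p y)\<^sup>2 = t * ((2 + t) * (rad p)\<^sup>2 + 2 * (- (p$1 * y$1 + p$2 * y$2)))"
    unfolding dist_sq_real3 rad_sq by (simp add: power2_eq_square algebra_simps)
  also have "\<dots> \<le> t * ((2 + t) * (rad p)\<^sup>2 + 2 * (rad p * rad y))"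
    using cs assms by (intro mult_left_mono add_left_mono) auto
  also have "\<dots> = (rad p + rad (push_out t p) + 2 * rad y) * (t * rad p)"
    unfolding rad_push_out[OF assms] by (simp add: power2_eq_square algebra_simps)
  finally show ?thesis .
qed

text \<open>Pairing \<open>y\<close> with its half-turn image cancels the first-order variation of the potential near
  the axis; convexity of \<open>u \<mapsto> 1 / sqrt u\<close> gives the remaining cross term the right sign.\<close>

lemma symmetrized_kernel_push_out_diff_le:
  assumes t: "t \<ge> 0"
    and far: "dist x y \<ge> 1" "dist x (rot3 pi y) \<ge> 1"
    and ne: "push_out t x \<noteq> y" "push_out t x \<noteq> rot3 pi y"
  shows "(1 / dist x y + 1 / dist x (rot3 pi y))
       - (1 / dist (push_out t x) y + 1 / dist (push_out t x) (rot3 pi y))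
       \<le> (rad (push_out t x))\<^sup>2 - (rad x)\<^sup>2"
proof -
  define x' where "x' = push_out t x"
  \<comment> \<open>The squared distances from \<open>x\<close> to \<open>y\<close> and to its image
    are \<open>A - w\<close> and \<open>A + w\<close>; pushing out replaces \<open>A\<close> by
    \<open>A'\<close> and multiplies the cross term \<open>w\<close> by
    \<open>1 + t\<close>.\<close>
  define c where "c = (rad y)\<^sup>2 + (x$3 - y$3)\<^sup>2"
  define A where "A = (rad x)\<^sup>2 + c"
  define A' where "A' = (rad x')\<^sup>2 + c"
  define w where "w = 2 * (x$1 * y$1 + x$2 * y$2)"
  define w' where "w' = (1 + t) * w"
  have d: "dist x y = sqrt (A - w)" "dist x (rot3 pi y) = sqrt (A + w)"
    "dist x' y = sqrt (A' - w')" "dist x' (rot3 pi y) = sqrt (A' + w')"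
    by (rule real_sqrt_unique[symmetric],
        simp add: dist_sq_real3 rot3_pi A_def A'_def w_def w'_def c_def x'_def rad_sq,
        simp add: power2_eq_square algebra_simps, simp)+
  have AA: "A \<le> A'"
  proof -
    have "rad x \<le> rad x'" unfolding x'_def rad_push_out[OF t] using t by (simp add: algebra_simps)
    then show ?thesis by (simp add: A_def A'_def power_mono)
  qed
  have one: "1 \<le> A - w" "1 \<le> A + w" using far unfolding d by auto
  have pos: "A' - w' > 0" "A' + w' > 0"
    using ne unfolding x'_def[symmetric] zero_less_dist_iff[symmetric] d by auto
  \<comment> \<open>Shrinking the cross term from \<open>w'\<close> back to \<open>w\<close> can
    only lower the sum. What remains is the change from \<open>A\<close> to \<open>A'\<close>, where
    the slope bound costs half the increment for each of the two terms.\<close>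
  have "1 / sqrt (A' - w) + 1 / sqrt (A' + w) \<le> 1 / sqrt (A' - w') + 1 / sqrt (A' + w')"
    by (rule symmetric_inverse_sqrt_mono[where \<tau>="1 / (1 + t)"]) (use t pos in \<open>auto simp: w'_def\<close>)
  moreover have "1 / sqrt (A - w) - 1 / sqrt (A' - w) \<le> (A' - A) / 2"
    using inverse_sqrt_diff_le[of "A - w" "A' - w"] one AA by simp
  moreover have "1 / sqrt (A + w) - 1 / sqrt (A' + w) \<le> (A' - A) / 2"
    using inverse_sqrt_diff_le[of "A + w" "A' + w"] one AA by simp
  moreover have "A' - A = (rad x')\<^sup>2 - (rad x)\<^sup>2" by (simp add: A_def A'_def)
  moreover have "(c1 + c2) - (b1 + b2) \<le> D"
    if "a1 + a2 \<le> b1 + b2" "c1 - a1 \<le> e / 2" "c2 - a2 \<le> e / 2" "e = D"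
    for a1 a2 b1 b2 c1 c2 e D :: real
    using that by linarith
  ultimately show ?thesis unfolding x'_def[symmetric] d by blast
qed

lemma (in tame_density) newton_potential_rot3_pi:
  assumes "\<And>y. w (rot3 pi y) = w y"
  shows "newton_potential w (rot3 pi x) = newton_potential w x"
proof -
  have "newton_potential w (rot3 pi x) = (\<integral>y. w (rot3 pi y) / dist x (rot3 pi y) \<partial>lebesgue)"
    unfolding newton_potential_def assms dist_rot3_pi ..
  also have "\<dots> = newton_potential w x"
    unfolding newton_potential_def by (rule integral_rot3_pi) measurable
  finally show ?thesis .
qed

text \<open>Average the kernel over \<open>y\<close> and its half-turn image and integrate the
  symmetrized bound. The result is controlled by the increment of the squared radius, as is the
  centrifugal gain, so a large rotation speed beats it even close to the axis. The hypothesis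
  \<open>ne\<close> keeps the end point off the density, where the convention
  \<open>1 / 0 = 0\<close> would spoil the estimate.\<close>

lemma (in tame_density) newton_potential_push_out_diff_le:
  assumes sym: "\<And>y. w (rot3 pi y) = w y" and t: "t \<ge> 0"
    and far: "\<And>y. w y \<noteq> 0 \<Longrightarrow> dist x y \<ge> 1" and ne: "w (push_out t x) = 0"
  shows "newton_potential w x - newton_potential w (push_out t x)
     \<le> ((rad (push_out t x))\<^sup>2 - (rad x)\<^sup>2) / 2 * (\<integral>y. w y \<partial>lebesgue)"
proof -
  define x' where "x' = push_out t x"
  let ?D = "(rad x')\<^sup>2 - (rad x)\<^sup>2"
  have int: "integrable lebesgue (\<lambda>y. w y / dist z (rot3 pi y))" for z
    using integrable_newton[of "rot3 pi z"] by (simp add: dist_rot3_pi)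
  have two: "2 * newton_potential w z = (\<integral>y. w y / dist z y + w y / dist z (rot3 pi y) \<partial>lebesgue)" for z
  proof -
    have "2 * newton_potential w z = newton_potential w z + newton_potential w (rot3 pi z)"
      using newton_potential_rot3_pi[OF sym] by simp
    then show ?thesis
      unfolding newton_potential_def dist_rot3_pi using integrable_newton[of z] int[of z] by simp
  qed
  have "2 * newton_potential w x - 2 * newton_potential w x' =
     (\<integral>y. (w y / dist x y + w y / dist x (rot3 pi y)) - (w y / dist x' y + w y / dist x' (rot3 pi y)) \<partial>lebesgue)"
    unfolding two using integrable_newton int by simp
  also have "\<dots> \<le> (\<integral>y. ?D * w y \<partial>lebesgue)"
  proof (rule integral_mono)
    fix y
    show "(w y / dist x y + w y / dist x (rot3 pi y)) - (w y / dist x' y + w y / dist x' (rot3 pi y)) \<le> ?D * w y"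
    proof (cases "w y = 0")
      case False
      then have f: "1 \<le> dist x y" "1 \<le> dist x (rot3 pi y)" using far sym by auto
      have n: "push_out t x \<noteq> y" "push_out t x \<noteq> rot3 pi y" using ne False sym by metis+
      show ?thesis
        using mult_left_mono[OF symmetrized_kernel_push_out_diff_le[OF t f n] nonneg[of y]]
        by (simp add: x'_def algebra_simps)
    qed simp
  qed (use integrable_newton int integrable in auto)
  also have "\<dots> = ?D * (\<integral>y. w y \<partial>lebesgue)" by simp
  finally show ?thesis by (simp add: x'_def algebra_simps)
qed

section \<open>The enthalpy function \<open>A'\<close>\<close>

lemma F2_near_zero:
  assumes "F2 f"
  obtains \<delta> where "\<delta> > 0" "\<And>t. 0 < t \<Longrightarrow> t < \<delta> \<Longrightarrow> f t \<le> t powr (4/3)"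
proof -
  have "((\<lambda>s. f s / s powr (4/3)) \<longlongrightarrow> 0) (at_right 0)" using assms by (simp add: F2_def)
  then have "eventually (\<lambda>s. f s / s powr (4/3) < 1) (at_right 0)"
    by (rule order_tendstoD) simp
  then obtain \<delta> where "\<delta> > 0" "\<And>t. 0 < t \<Longrightarrow> t < \<delta> \<Longrightarrow> f t / t powr (4/3) < 1"
    unfolding eventually_at_right_field by blast
  then show thesis by (intro that[of \<delta>]) (auto simp: field_simps intro: less_imp_le)
qed

text \<open>The integrand is dominated by \<open>t powr (-2/3)\<close>, which is integrable at
  0.\<close>

lemma Aprime_integrand_near_zero:
  assumes "F1 f" "0 \<le> s" "\<And>t. 0 < t \<Longrightarrow> t \<le> s \<Longrightarrow> f t \<le> t powr (4/3)"
  shows "(\<lambda>t. f t / t\<^sup>2) integrable_on {0..s}"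
    and "integral {0..s} (\<lambda>t. f t / t\<^sup>2) \<le> 3 * s powr (1/3)"
proof -
  have f: "continuous_on {0..} f" "\<And>t. t \<ge> 0 \<Longrightarrow> f t \<ge> 0" using assms(1) by (auto simp: F1_def)
  have le: "norm (f t / t\<^sup>2) \<le> t powr (-2/3)" if "t \<in> {0..s}" for t
  proof (cases "t = 0")
    case False
    then have t: "t > 0" using that by simp
    have "f t / t\<^sup>2 \<le> t powr (4/3) / t\<^sup>2" using assms(3)[of t] t that by (intro divide_right_mono) auto
    also have "\<dots> = t powr (4/3) / t powr 2" using t by simp
    also have "\<dots> = t powr (-2/3)" by (simp only: powr_diff[symmetric]) simp
    finally show ?thesis using f(2)[of t] t by simp
  qed simp
  have g: "(\<lambda>t. t powr (-2/3)) integrable_on {0..s}"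
    by (rule integrable_on_powr_from_0) (use assms in auto)
  have "f \<in> borel_measurable (lebesgue_on {0..s})"
    by (rule continuous_imp_measurable_on_sets_lebesgue[OF continuous_on_subset[OF f(1)]]) auto
  moreover have "(\<lambda>t::real. t\<^sup>2) \<in> borel_measurable (lebesgue_on {0..s})"
    by (rule continuous_imp_measurable_on_sets_lebesgue) (auto intro!: continuous_intros)
  ultimately have m: "(\<lambda>t. f t / t\<^sup>2) \<in> borel_measurable (lebesgue_on {0..s})"
    by (rule borel_measurable_divide)
  show int: "(\<lambda>t. f t / t\<^sup>2) integrable_on {0..s}"
    by (rule measurable_bounded_by_integrable_imp_integrable[OF m g le]) auto
  have "integral {0..s} (\<lambda>t. f t / t\<^sup>2) \<le> integral {0..s} (\<lambda>t. t powr (-2/3))"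
  proof (rule integral_le[OF int g])
    fix t assume "t \<in> {0..s}"
    from le[OF this] show "f t / t\<^sup>2 \<le> t powr (-2/3)"
      unfolding real_norm_def by (rule order_trans[OF abs_ge_self])
  qed
  also have "\<dots> = 3 * s powr (1/3)"
    using has_integral_powr_from_0[of "-2/3" s, THEN integral_unique] assms by simp
  finally show "integral {0..s} (\<lambda>t. f t / t\<^sup>2) \<le> 3 * s powr (1/3)" .
qed

lemma Aprime_integrand_integrable:
  assumes "F1 f" "F2 f" "s \<ge> 0"
  shows "(\<lambda>t. f t / t\<^sup>2) integrable_on {0..s}"
proof -
  obtain \<delta> where d: "\<delta> > 0" "\<And>t. 0 < t \<Longrightarrow> t < \<delta> \<Longrightarrow> f t \<le> t powr (4/3)"
    using F2_near_zero[OF assms(2)] by blast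
  show ?thesis
  proof (cases "s < \<delta>")
    case True
    show ?thesis by (rule Aprime_integrand_near_zero(1)[OF assms(1,3)]) (use d(2) True in auto)
  next
    case False
    have f: "continuous_on {0..} f" using assms(1) by (simp add: F1_def)
    have i1: "(\<lambda>t. f t / t\<^sup>2) integrable_on {0..\<delta>/2}"
      by (rule Aprime_integrand_near_zero(1)[OF assms(1)]) (use d in auto)
    have "continuous_on {\<delta>/2..s} f"
      by (rule continuous_on_subset[OF f]) (use d(1) in auto)
    then have "continuous_on {\<delta>/2..s} (\<lambda>t. f t / t\<^sup>2)"
      by (rule continuous_on_divide) (use d(1) in \<open>auto intro!: continuous_intros\<close>)
    then have i2: "(\<lambda>t. f t / t\<^sup>2) integrable_on {\<delta>/2..s}"
      by (rule integrable_continuous_interval)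
    show ?thesis
      by (rule Henstock_Kurzweil_Integration.integrable_combine[OF _ _ i1 i2]) (use False d(1) in auto)
  qed
qed

lemma Aprime_ge:
  assumes "F1 f" "s \<ge> 0"
  shows "f s / s \<le> Aprime f s"
proof -
  have "0 \<le> integral {0..s} (\<lambda>t. f t / t\<^sup>2)"
  proof (cases "(\<lambda>t. f t / t\<^sup>2) integrable_on {0..s}")
    case True
    then show ?thesis using assms by (intro Henstock_Kurzweil_Integration.integral_nonneg) (auto simp: F1_def)
  qed (simp add: not_integrable_integral)
  then show ?thesis by (simp add: Aprime_def)
qed

lemma Aprime_nonneg:
  assumes "F1 f" "s \<ge> 0"
  shows "Aprime f s \<ge> 0"
proof -
  have "0 \<le> f s / s" using assms by (simp add: F1_def)
  then show ?thesis using Aprime_ge[OF assms] by linarith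
qed

text \<open>Since \<open>f\<close> is at least \<open>f s\<close> on the interval from
  \<open>s\<close> to \<open>s'\<close>, the integral grows by at least
  \<open>f s / s - f s / s'\<close>. This makes up for the loss in the quotient, and
  \<open>f s < f s'\<close> gives strictness.\<close>

lemma Aprime_less:
  assumes "F1 f" "F2 f" "0 < s" "s < s'"
  shows "Aprime f s < Aprime f s'"
proof -
  let ?g = "\<lambda>t. f t / t\<^sup>2"
  have smono: "f s < f s'" using assms by (auto simp: F1_def strict_mono_on_def)
  have mono: "f s \<le> f t" if "s \<le> t" for t
    using assms that by (cases "s = t") (auto simp: F1_def strict_mono_on_def less_imp_le)
  have i: "?g integrable_on {0..s'}" by (rule Aprime_integrand_integrable) (use assms in auto)
  then have i2: "?g integrable_on {s..s'}"
    using assms by (elim integrable_on_subinterval) auto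
  have comb: "integral {0..s} ?g + integral {s..s'} ?g = integral {0..s'} ?g"
    using assms i by (intro Henstock_Kurzweil_Integration.integral_combine) auto
  have "((\<lambda>t. f s / t\<^sup>2) has_integral (- f s / s' - - f s / s)) {s..s'}"
  proof (rule fundamental_theorem_of_calculus)
    fix t assume "t \<in> {s..s'}"
    then have "t \<noteq> 0" using assms by auto
    then show "((\<lambda>t. - f s / t) has_vector_derivative f s / t\<^sup>2) (at t within {s..s'})"
      unfolding has_real_derivative_iff_has_vector_derivative[symmetric]
      by (auto intro!: derivative_eq_intros simp: power2_eq_square)
  qed (use assms in auto)
  then have "- f s / s' - - f s / s \<le> integral {s..s'} ?g"
    using i2 mono assms by (intro has_integral_le[OF _ integrable_integral[OF i2]])
      (auto intro!: divide_right_mono)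
  moreover have "f s / s' < f s' / s'" using smono assms by (simp add: divide_strict_right_mono)
  ultimately show ?thesis using comb by (simp add: Aprime_def)
qed

lemma Aprime_small:
  assumes "F1 f" "F2 f" "\<epsilon> > 0"
  obtains \<eta> where "\<eta> > 0" "Aprime f \<eta> \<le> \<epsilon>"
proof -
  obtain \<delta> where d: "\<delta> > 0" "\<And>t. 0 < t \<Longrightarrow> t < \<delta> \<Longrightarrow> f t \<le> t powr (4/3)"
    using F2_near_zero[OF assms(2)] by blast
  \<comment> \<open>The cube root of \<open>\<eta>\<close> is at most \<open>\<epsilon>/4\<close>:
    the integral takes three such shares and the quotient \<open>f \<eta> / \<eta>\<close>
    one.\<close>
  define \<eta> where "\<eta> = min (\<delta>/2) ((\<epsilon>/4) powr 3)"
  have e: "\<eta> > 0" "\<eta> < \<delta>" using d(1) assms(3) by (auto simp: \<eta>_def)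
  have "\<eta> powr (1/3) \<le> ((\<epsilon>/4) powr 3) powr (1/3)" using e by (intro powr_mono2) (auto simp: \<eta>_def)
  also have "\<dots> = \<epsilon>/4" using assms(3) by (simp add: powr_powr del: powr_numeral)
  finally have root: "\<eta> powr (1/3) \<le> \<epsilon>/4" .
  have "integral {0..\<eta>} (\<lambda>t. f t / t\<^sup>2) \<le> 3 * \<eta> powr (1/3)"
    by (rule Aprime_integrand_near_zero(2)[OF assms(1)]) (use d(2) e in auto)
  moreover have "f \<eta> / \<eta> \<le> \<eta> powr (1/3)"
  proof -
    have "f \<eta> / \<eta> \<le> \<eta> powr (4/3) / \<eta> powr 1" using d(2)[of \<eta>] e by (simp add: divide_right_mono)
    also have "\<dots> = \<eta> powr (1/3)" by (simp only: powr_diff[symmetric]) simp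
    finally show ?thesis .
  qed
  ultimately have "Aprime f \<eta> \<le> \<epsilon>" using root by (simp add: Aprime_def)
  then show thesis using that e by blast
qed

section \<open>Rotating stars\<close>

text \<open>Here \<open>c\<close> is the constant of the equilibrium equation. The bound
  \<open>\<sigma>\<close> may depend on the star: it makes suprema finite and limits the growth
  along rays, but enters no quantitative conclusion.\<close>

locale rotating_star =
  fixes f :: "real \<Rightarrow> real" and K :: "(real^3) set" and \<rho> B \<Phi> :: "real^3 \<Rightarrow> real"
    and \<Omega> c \<sigma> :: real
  assumes F: "F1 f" "F2 f" and trap: "no_trapping K"
    and cont: "continuous_on (- K) \<rho>" and rho_le: "x \<notin> K \<Longrightarrow> \<rho> x \<le> \<sigma>"
    and Omega: "\<Omega> > 0"
    and B_nonneg: "B x \<ge> 0" and Phi_nonneg: "\<Phi> x \<ge> 0"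
    and balance: "x \<notin> K \<Longrightarrow> \<rho> x > 0 \<Longrightarrow> Aprime f (\<rho> x) = B x + \<Omega>\<^sup>2 * (rad x)\<^sup>2 / 2 + \<Phi> x + c"
begin

lemma push_out_notin: "p \<notin> K \<Longrightarrow> t \<ge> 0 \<Longrightarrow> push_out t p \<notin> K"
  using trap by (simp add: no_trapping_def push_out_def)

lemma ray_attains:
  assumes p: "p \<notin> K" "rad p > 0" and eta: "0 < \<eta>" "\<eta> < \<rho> p"
  obtains t where "t > 0" "\<rho> (push_out t p) = \<eta>"
proof -
  have c: "continuous_on {0..} (\<lambda>t. \<rho> (push_out t p))"
  proof (rule continuous_on_compose2[OF cont])
    show "continuous_on {0..} (\<lambda>t. push_out t p)" unfolding push_out_def by (intro continuous_intros)
  qed (use push_out_notin[OF p(1)] in auto)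
  have zero: "push_out 0 p = p" by (simp add: push_out_def)
  have "\<exists>T\<ge>0. \<rho> (push_out T p) \<le> \<eta>"
  proof (rule ccontr)
    assume "\<not> ?thesis"
    then have above: "\<rho> (push_out t p) > \<eta>" if "t \<ge> 0" for t using that by force
    \<comment> \<open>If \<open>\<rho>\<close> stayed above \<open>\<eta>\<close>, the balance at
      parameter \<open>H\<close> would bound \<open>(1 + H)\<^sup>2\<close> by the second argument
      of this maximum, hence by \<open>H\<close>, which is impossible.\<close>
    define H where "H = max 0 (2 * (Aprime f \<sigma> - c) / (\<Omega>\<^sup>2 * (rad p)\<^sup>2))"
    let ?x = "push_out H p"
    have H: "H \<ge> 0" by (simp add: H_def)
    have x: "?x \<notin> K" "\<rho> ?x > 0" "\<rho> ?x \<le> \<sigma>"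
      using push_out_notin[OF p(1) H] above[OF H] eta rho_le by auto
    have pos: "\<Omega>\<^sup>2 * (rad p)\<^sup>2 > 0" using Omega p by simp
    have "Aprime f (\<rho> ?x) \<le> Aprime f \<sigma>"
      using Aprime_less[OF F x(2)] x(3) by (cases "\<rho> ?x = \<sigma>") (auto simp: less_imp_le)
    moreover have "Aprime f (\<rho> ?x) \<ge> \<Omega>\<^sup>2 * (rad ?x)\<^sup>2 / 2 + c"
      using balance[OF x(1,2)] B_nonneg[of ?x] Phi_nonneg[of ?x] by simp
    ultimately have "\<Omega>\<^sup>2 * (rad ?x)\<^sup>2 \<le> 2 * (Aprime f \<sigma> - c)" by simp
    moreover have "\<Omega>\<^sup>2 * (rad ?x)\<^sup>2 = (1 + H)\<^sup>2 * (\<Omega>\<^sup>2 * (rad p)\<^sup>2)"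
      by (simp add: rad_push_out[OF H] power_mult_distrib)
    ultimately have "(1 + H)\<^sup>2 \<le> 2 * (Aprime f \<sigma> - c) / (\<Omega>\<^sup>2 * (rad p)\<^sup>2)"
      by (subst pos_le_divide_eq[OF pos]) simp
    also have "\<dots> \<le> H" by (simp add: H_def)
    finally have "(1 + H)\<^sup>2 \<le> H" .
    moreover have "(1 + H)\<^sup>2 = 1 + 2 * H + H\<^sup>2" by (simp add: power2_eq_square algebra_simps)
    ultimately show False using H zero_le_power2[of H] by linarith
  qed
  then obtain T where T: "T \<ge> 0" "\<rho> (push_out T p) \<le> \<eta>" by blast
  have "\<exists>t\<ge>0. t \<le> T \<and> \<rho> (push_out t p) = \<eta>"
    by (rule IVT2') (use T eta zero continuous_on_subset[OF c] in auto)
  then obtain t where t: "t \<ge> 0" "\<rho> (push_out t p) = \<eta>" by blast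
  moreover have "t \<noteq> 0" using t(2) zero eta by auto
  ultimately show thesis by (intro that[of t]) auto
qed

text \<open>Subtracting the balance equations at the two ends eliminates \<open>c\<close>. As
  \<open>A'\<close> is strictly increasing the left side is positive, so \<open>B\<close> and
  \<open>\<Phi>\<close> together must fall by more than the centrifugal gain.\<close>

lemma ray_drop:
  assumes p: "p \<notin> K" "rad p > 0" and eta: "0 < \<eta>" "\<eta> < \<rho> p"
  obtains t where "t > 0" "push_out t p \<notin> K" "rad (push_out t p) > rad p" "\<rho> (push_out t p) = \<eta>"
    "Aprime f (\<rho> p) - Aprime f \<eta> = (B p - B (push_out t p)) + (\<Phi> p - \<Phi> (push_out t p))
       - \<Omega>\<^sup>2 * ((rad (push_out t p))\<^sup>2 - (rad p)\<^sup>2) / 2"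
proof -
  obtain t where t: "t > 0" "\<rho> (push_out t p) = \<eta>" using ray_attains[OF assms] by blast
  have n: "push_out t p \<notin> K" using push_out_notin p t by simp
  have r: "rad (push_out t p) > rad p" using t p by (simp add: rad_push_out algebra_simps)
  have "Aprime f (\<rho> p) = B p + \<Omega>\<^sup>2 * (rad p)\<^sup>2 / 2 + \<Phi> p + c"
    using balance[OF p(1)] eta by simp
  moreover have "Aprime f \<eta> = B (push_out t p) + \<Omega>\<^sup>2 * (rad (push_out t p))\<^sup>2 / 2 + \<Phi> (push_out t p) + c"
    using balance[OF n] eta t by simp
  ultimately show thesis using t n r by (intro that[of t]) (auto simp: field_simps)
qed

text \<open>Follow the ray from a nearly densest point down to density 1. The drop bounds
  \<open>A'\<close> at \<open>u = \<rho> p\<close> by a constant times \<open>u powr (1/3)\<close>,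
  whereas \<open>A'\<close> is at least \<open>f u / u\<close>, which grows faster.\<close>

lemma density_le_uniform:
  assumes N: "\<And>s. s \<ge> s\<^sub>0 \<Longrightarrow> f s / s \<ge> N * s powr (1/3)" "s\<^sub>0 \<ge> 1"
    and Phi: "\<And>x. \<Phi> x \<le> C\<^sub>\<Phi>"
    and B: "\<And>S x. S > 0 \<Longrightarrow> \<forall>x. x \<notin> K \<longrightarrow> rad x > 0 \<longrightarrow> \<rho> x \<le> S \<Longrightarrow> B x \<le> C\<^sub>B * S powr (1/3)"
    and C: "C\<^sub>B \<ge> 0" "C\<^sub>\<Phi> \<ge> 0" "N > Aprime f 1 + C\<^sub>\<Phi> + 2 * C\<^sub>B"
    and x: "x \<notin> K" "rad x > 0"
  shows "\<rho> x \<le> 2 * s\<^sub>0"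
proof (rule ccontr)
  assume "\<not> \<rho> x \<le> 2 * s\<^sub>0"
  \<comment> \<open>The supremum runs over points off the axis, because only these have a moving
    ray. It need not be attained; a point with more than half of it costs the factor 2 in front of
    \<open>C\<^sub>B\<close>.\<close>
  define X where "X = {\<rho> y | y. y \<notin> K \<and> rad y > 0}"
  define S where "S = Sup X"
  have bdd: "bdd_above X" unfolding X_def using rho_le by (intro bdd_aboveI[of _ \<sigma>]) auto
  have ub: "\<rho> y \<le> S" if "y \<notin> K" "rad y > 0" for y
    unfolding S_def using that bdd by (intro cSup_upper) (auto simp: X_def)
  have S: "S > 2 * s\<^sub>0" using ub[OF x] \<open>\<not> \<rho> x \<le> 2 * s\<^sub>0\<close> by linarith
  then have "S / 2 < Sup X" using N(2) by (simp add: S_def)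
  moreover have "X \<noteq> {}" using x by (auto simp: X_def)
  ultimately obtain p where p: "p \<notin> K" "rad p > 0" "\<rho> p > S / 2"
    using less_cSup_iff[of X "S/2"] bdd by (auto simp: X_def)
  define u where "u = \<rho> p"
  have u: "u \<ge> s\<^sub>0" "u > 1" "S \<le> 2 * u" using p S N(2) by (auto simp: u_def)
  have e: "0 < (1::real)" "1 < \<rho> p" using u(2) by (simp_all add: u_def)
  obtain t where "t > 0" "push_out t p \<notin> K" and t: "rad (push_out t p) > rad p" and "\<rho> (push_out t p) = 1"
    and t': "Aprime f (\<rho> p) - Aprime f 1 = (B p - B (push_out t p)) + (\<Phi> p - \<Phi> (push_out t p))
       - \<Omega>\<^sup>2 * ((rad (push_out t p))\<^sup>2 - (rad p)\<^sup>2) / 2"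
    by (rule ray_drop[OF p(1,2) e])
  have "(rad p)\<^sup>2 \<le> (rad (push_out t p))\<^sup>2" using t by (intro power_mono) auto
  then have "0 \<le> \<Omega>\<^sup>2 * ((rad (push_out t p))\<^sup>2 - (rad p)\<^sup>2) / 2" by simp
  then have "Aprime f u \<le> Aprime f 1 + B p + \<Phi> p"
    using t' B_nonneg[of "push_out t p"] Phi_nonneg[of "push_out t p"] unfolding u_def by linarith
  also have "\<dots> \<le> Aprime f 1 + C\<^sub>B * S powr (1/3) + C\<^sub>\<Phi>"
    using B[of S p] Phi[of p] ub S N(2) by auto
  also have "\<dots> \<le> Aprime f 1 + C\<^sub>B * (2 * u powr (1/3)) + C\<^sub>\<Phi>"
  proof -
    have "S powr (1/3) \<le> (2 * u) powr (1/3)" using u S N(2) by (intro powr_mono2) auto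
    also have "\<dots> = 2 powr (1/3) * u powr (1/3)" using u by (simp add: powr_mult)
    also have "\<dots> \<le> 2 powr 1 * u powr (1/3)" by (intro mult_right_mono powr_mono) auto
    finally show ?thesis using C by (simp add: mult_left_mono)
  qed
  also have "\<dots> \<le> (Aprime f 1 + C\<^sub>\<Phi> + 2 * C\<^sub>B) * u powr (1/3)"
  proof -
    have "(Aprime f 1 + C\<^sub>\<Phi>) * 1 \<le> (Aprime f 1 + C\<^sub>\<Phi>) * u powr (1/3)"
      using u C Aprime_nonneg[OF F(1), of 1] by (intro mult_left_mono) (auto simp: ge_one_powr_ge_zero)
    then show ?thesis by (simp add: algebra_simps)
  qed
  also have "\<dots> < N * u powr (1/3)" using C(3) u by (intro mult_strict_right_mono) auto
  also have "\<dots> \<le> f u / u" using N(1)[OF u(1)] .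
  also have "\<dots> \<le> Aprime f u" using Aprime_ge[OF F(1)] u by simp
  finally show False by simp
qed

text \<open>Drop to half the density over a displacement \<open>d\<close>. The potentials fall by at
  most \<open>(L\<^sub>B + L\<^sub>\<Phi>) * d\<close>, while the centrifugal term gains more than
  \<open>\<Omega>\<^sup>2 * rad p * d\<close>; divide by \<open>d\<close>.\<close>

lemma rad_less:
  assumes lip: "\<And>x y. B x - B y \<le> L\<^sub>B * dist x y" "\<And>x y. \<Phi> x - \<Phi> y \<le> L\<^sub>\<Phi> * dist x y"
    and p: "p \<notin> K" "rad p > 0" "\<rho> p > 0"
  shows "rad p < (L\<^sub>B + L\<^sub>\<Phi>) / \<Omega>\<^sup>2"
proof -
  have e: "0 < \<rho> p / 2" "\<rho> p / 2 < \<rho> p" using p(3) by simp_all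
  obtain t where t: "t > 0" and "push_out t p \<notin> K" "rad (push_out t p) > rad p" "\<rho> (push_out t p) = \<rho> p / 2"
    and t': "Aprime f (\<rho> p) - Aprime f (\<rho> p / 2) = (B p - B (push_out t p)) + (\<Phi> p - \<Phi> (push_out t p))
       - \<Omega>\<^sup>2 * ((rad (push_out t p))\<^sup>2 - (rad p)\<^sup>2) / 2"
    by (rule ray_drop[OF p(1,2) e])
  define d where "d = t * rad p"
  have d: "d > 0" using t p by (simp add: d_def)
  have r': "rad (push_out t p) = rad p + d" using t by (simp add: rad_push_out d_def algebra_simps)
  have dd: "dist p (push_out t p) = d" using t by (simp add: dist_push_out d_def)
  have "0 < Aprime f (\<rho> p) - Aprime f (\<rho> p / 2)" using Aprime_less[OF F, of "\<rho> p / 2" "\<rho> p"] p by simp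
  also have "\<dots> \<le> L\<^sub>B * d + L\<^sub>\<Phi> * d - \<Omega>\<^sup>2 * ((rad p + d)\<^sup>2 - (rad p)\<^sup>2) / 2"
    unfolding t' r' using lip(1)[of p "push_out t p"] lip(2)[of p "push_out t p"] dd by simp
  also have "\<dots> = d * ((L\<^sub>B + L\<^sub>\<Phi>) - \<Omega>\<^sup>2 * rad p - \<Omega>\<^sup>2 * d / 2)"
    by (simp add: power2_eq_square algebra_simps)
  finally have "0 < (L\<^sub>B + L\<^sub>\<Phi>) - \<Omega>\<^sup>2 * rad p - \<Omega>\<^sup>2 * d / 2"
    using d by (simp add: zero_less_mult_iff)
  moreover have "\<Omega>\<^sup>2 * d \<ge> 0" using d by simp
  ultimately have "\<Omega>\<^sup>2 * rad p < L\<^sub>B + L\<^sub>\<Phi>" by linarith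
  then show ?thesis using Omega by (simp add: field_simps)
qed

end

text \<open>The axis lies in a coordinate hyperplane. So bounds proved off the axis hold almost
  everywhere.\<close>

lemma AE_rad_pos: "AE y in lebesgue. rad y > 0"
proof -
  have "negligible {y::real^3. y$1 = 0}" by (rule negligible_standard_hyperplane_cart)
  then have "AE y in lebesgue. y \<notin> {y::real^3. y$1 = 0}"
    by (intro AE_not_in) (simp add: negligible_iff_null_sets)
  then show ?thesis
  proof eventually_elim
    case (elim y)
    then have "0 < \<bar>y$1\<bar>" by simp
    also have "\<dots> \<le> rad y" by (rule abs_nth_le_rad)
    finally show ?case .
  qed
qed

context rotating_star begin

text \<open>A point whose distance to the axis exceeds half of the largest one occurring can only be
  pulled inwards by mass inside the cylinder of radius \<open>R\<close>, with a force of order \<open>R\<close>; this is beaten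
  by the centrifugal force, so the ray through that point cannot leave the star.\<close>

lemma widest_point_contradiction:
  assumes B: "B = newton_potential w" and w: "w = (\<lambda>y. indicator (- K) y * \<rho> y)" "tame_density w L"
    and S: "\<And>x. x \<notin> K \<Longrightarrow> rad x > 0 \<Longrightarrow> \<rho> x \<le> S" "S \<ge> 0"
    and width: "\<And>x. x \<notin> K \<Longrightarrow> rad x > 0 \<Longrightarrow> \<rho> x > 0 \<Longrightarrow> rad x \<le> R'"
    and C0: "C \<ge> 0" and ex: "x\<^sub>0 \<notin> K" "rad x\<^sub>0 > 0" "\<rho> x\<^sub>0 > 0"
    and C: "\<And>(x::real^3) R. R > 0 \<Longrightarrow>
        integrable lebesgue (\<lambda>y. indicator {y. rad y \<le> R} y * cyl_kernel R (dist x y))"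
      "\<And>(x::real^3) R. R > 0 \<Longrightarrow>
        integral\<^sup>L lebesgue (\<lambda>y. indicator {y. rad y \<le> R} y * cyl_kernel R (dist x y)) \<le> C * R"
    and Phi: "\<And>p t. p \<notin> K \<Longrightarrow> rad p > 0 \<Longrightarrow> \<rho> p > 0 \<Longrightarrow> t > 0 \<Longrightarrow> push_out t p \<notin> K \<Longrightarrow>
        \<Phi> p - \<Phi> (push_out t p) \<le> ((rad (push_out t p))\<^sup>2 - (rad p)\<^sup>2) / 2 * m"
    and large: "\<Omega>\<^sup>2 \<ge> m + 2 * C * S"
  shows False
proof -
  interpret tame_density w L by (rule w(2))
  define X where "X = {rad x | x. x \<notin> K \<and> rad x > 0 \<and> \<rho> x > 0}"
  define R where "R = Sup X"
  have bdd: "bdd_above X" unfolding X_def using width by (intro bdd_aboveI[of _ R']) auto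
  have ub: "rad x \<le> R" if "x \<notin> K" "rad x > 0" "\<rho> x > 0" for x
    unfolding R_def using that bdd by (intro cSup_upper) (auto simp: X_def)
  have R: "R > 0" using ub[OF ex] ex(2) by linarith
  have "X \<noteq> {}" using ex by (auto simp: X_def)
  moreover have "R / 2 < Sup X" using R by (simp add: R_def)
  ultimately obtain p where p: "p \<notin> K" "rad p > 0" "\<rho> p > 0" "rad p > R / 2"
    using less_cSup_iff[of X "R/2"] bdd by (auto simp: X_def)
  have e: "0 < \<rho> p / 2" "\<rho> p / 2 < \<rho> p" using p(3) by simp_all
  obtain t where t: "t > 0" "push_out t p \<notin> K" "rad (push_out t p) > rad p" "\<rho> (push_out t p) = \<rho> p / 2"
    and drop: "Aprime f (\<rho> p) - Aprime f (\<rho> p / 2) = (B p - B (push_out t p)) + (\<Phi> p - \<Phi> (push_out t p))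
       - \<Omega>\<^sup>2 * ((rad (push_out t p))\<^sup>2 - (rad p)\<^sup>2) / 2"
    by (rule ray_drop[OF p(1,2) e])
  define d where "d = t * rad p"
  have d: "d > 0" using t p by (simp add: d_def)
  have r': "rad (push_out t p) = rad p + d" using t by (simp add: rad_push_out d_def algebra_simps)
  have dd: "d = dist p (push_out t p)" using t by (simp add: dist_push_out d_def)
  \<comment> \<open>The end point still has positive density, so it obeys the same maximal radius,
    and so does the displacement.\<close>
  have rR: "rad (push_out t p) \<le> R" using ub[of "push_out t p"] t p by simp
  have dR: "d \<le> R" using r' rR p(2) by linarith
  have ae1: "AE y in lebesgue. w y \<le> S"
    using AE_rad_pos by eventually_elim (use S in \<open>auto simp: w(1) indicator_def\<close>)
  have ae2: "AE y in lebesgue. w y \<noteq> 0 \<longrightarrow> rad y \<le> R"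
    using AE_rad_pos
  proof eventually_elim
    case (elim y)
    show ?case using ub[of y] nonneg[of y] elim by (auto simp: w(1) indicator_def split: if_splits)
  qed
  have closer: "(dist (push_out t p) y)\<^sup>2 - (dist p y)\<^sup>2 \<le> 4 * R * d" if "rad y \<le> R" for y
  proof -
    have "(dist (push_out t p) y)\<^sup>2 - (dist p y)\<^sup>2 \<le> (rad p + rad (push_out t p) + 2 * rad y) * d"
      unfolding d_def by (rule dist_sq_push_out_diff_le) (use t in simp)
    also have "\<dots> \<le> (4 * R) * d" using d that rR t(3) by (intro mult_right_mono) auto
    finally show ?thesis .
  qed
  have Bd: "B p - B (push_out t p) \<le> C * S * R * d"
    unfolding B by (rule newton_potential_cylinder_diff_le[OF ae1 ae2 R dd dR closer C[OF R] S(2)])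
  define E where "E = (rad (push_out t p))\<^sup>2 - (rad p)\<^sup>2"
  \<comment> \<open>The choice \<open>rad p > R / 2\<close> enters here: the gain in squared radius
    is at least \<open>R * d\<close>, the order of the self-attraction.\<close>
  have E: "E \<ge> R * d"
  proof -
    have "E = (2 * rad p + d) * d" unfolding E_def r' by (simp add: power2_eq_square algebra_simps)
    moreover have "R * d \<le> (2 * rad p + d) * d" using p(4) d by (intro mult_right_mono) auto
    ultimately show ?thesis by simp
  qed
  have "0 < Aprime f (\<rho> p) - Aprime f (\<rho> p / 2)" using Aprime_less[OF F e] by simp
  also have "\<dots> \<le> C * S * R * d + E / 2 * m - \<Omega>\<^sup>2 * E / 2"
    unfolding drop using Bd Phi[OF p(1-3) t(1,2)] by (simp add: E_def)
  also have "\<dots> \<le> 0"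
  proof -
    have "C * S * (R * d) \<le> C * S * E" using E C0 S(2) by (intro mult_left_mono) auto
    moreover have "(m + 2 * C * S) * E \<le> \<Omega>\<^sup>2 * E"
      using large E R d by (intro mult_right_mono) (auto intro: order_trans[rotated])
    ultimately show ?thesis by (simp add: algebra_simps)
  qed
  finally show False by simp
qed

text \<open>Thinness limits a drop along a ray to \<open>L * R\<close>, so \<open>A'\<close> is at
  most \<open>c\<^sub>0 / 2\<close> at \<open>p\<^sub>0\<close>, and the balance there forces
  \<open>c \<le> - c\<^sub>0 / 2\<close>. At any other point of the star \<open>A'\<close> is
  nonnegative while \<open>B\<close> and the centrifugal term are at most
  \<open>c\<^sub>0 / 8\<close> each; \<open>\<Phi>\<close> must supply the rest.\<close>

lemma Phi_ge_of_near_point: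
  assumes lip: "\<And>x y. B x - B y \<le> L\<^sub>B * dist x y" "\<And>x y. \<Phi> x - \<Phi> y \<le> L\<^sub>\<Phi> * dist x y"
    and L: "L = L\<^sub>B + L\<^sub>\<Phi>" "L \<ge> 0" and R: "R = L / \<Omega>\<^sup>2"
    and small: "L * R \<le> c\<^sub>0 / 4" "\<And>x. B x \<le> c\<^sub>0 / 8" "c\<^sub>0 > 0"
    and p0: "p\<^sub>0 \<notin> K" "rad p\<^sub>0 > 0" "\<rho> p\<^sub>0 > 0" "\<Phi> p\<^sub>0 \<ge> c\<^sub>0"
    and p: "p \<notin> K" "rad p > 0" "\<rho> p > 0"
  shows "\<Phi> p \<ge> c\<^sub>0 / 4"
proof -
  have thin: "rad x < R" if "x \<notin> K" "rad x > 0" "\<rho> x > 0" for x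
    using rad_less[OF lip that] by (simp add: R L)
  obtain \<eta> where eta: "\<eta> > 0" "Aprime f \<eta> \<le> c\<^sub>0 / 4"
    using Aprime_small[OF F, of "c\<^sub>0 / 4"] small(3) by auto
  have "Aprime f (\<rho> p\<^sub>0) \<le> c\<^sub>0 / 2"
  proof (cases "\<eta> < \<rho> p\<^sub>0")
    case False
    then have "Aprime f (\<rho> p\<^sub>0) \<le> Aprime f \<eta>"
      using Aprime_less[OF F p0(3), of \<eta>] by (cases "\<rho> p\<^sub>0 = \<eta>") auto
    then show ?thesis using eta small(3) by linarith
  next
    case True
    obtain t where t: "t > 0" "push_out t p\<^sub>0 \<notin> K" "rad (push_out t p\<^sub>0) > rad p\<^sub>0" "\<rho> (push_out t p\<^sub>0) = \<eta>"
      and drop: "Aprime f (\<rho> p\<^sub>0) - Aprime f \<eta> = (B p\<^sub>0 - B (push_out t p\<^sub>0)) + (\<Phi> p\<^sub>0 - \<Phi> (push_out t p\<^sub>0))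
         - \<Omega>\<^sup>2 * ((rad (push_out t p\<^sub>0))\<^sup>2 - (rad p\<^sub>0)\<^sup>2) / 2"
      by (rule ray_drop[OF p0(1,2) eta(1) True])
    have "dist p\<^sub>0 (push_out t p\<^sub>0) = rad (push_out t p\<^sub>0) - rad p\<^sub>0"
      using t(1) by (simp add: dist_push_out rad_push_out algebra_simps)
    also have "\<dots> \<le> R" using thin[OF t(2)] t p0 eta by (simp add: less_imp_le)
    finally have "L * dist p\<^sub>0 (push_out t p\<^sub>0) \<le> L * R" using L(2) by (rule mult_left_mono)
    moreover have "L * dist p\<^sub>0 (push_out t p\<^sub>0) = L\<^sub>B * dist p\<^sub>0 (push_out t p\<^sub>0) + L\<^sub>\<Phi> * dist p\<^sub>0 (push_out t p\<^sub>0)"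
      by (simp add: L(1) algebra_simps)
    moreover have "(rad p\<^sub>0)\<^sup>2 \<le> (rad (push_out t p\<^sub>0))\<^sup>2" using t(3) by (intro power_mono) auto
    then have "0 \<le> \<Omega>\<^sup>2 * ((rad (push_out t p\<^sub>0))\<^sup>2 - (rad p\<^sub>0)\<^sup>2) / 2" by simp
    ultimately show ?thesis
      using drop lip(1)[of p\<^sub>0 "push_out t p\<^sub>0"] lip(2)[of p\<^sub>0 "push_out t p\<^sub>0"] small(1) eta(2) by linarith
  qed
  moreover have "0 \<le> \<Omega>\<^sup>2 * (rad p\<^sub>0)\<^sup>2 / 2" by simp
  ultimately have c: "c \<le> - c\<^sub>0 / 2"
    using balance[OF p0(1,3)] B_nonneg[of p\<^sub>0] p0(4) by linarith
  have "\<Omega>\<^sup>2 * (rad p)\<^sup>2 / 2 \<le> c\<^sub>0 / 8"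
  proof -
    have "(rad p)\<^sup>2 \<le> R\<^sup>2" using thin[OF p] by (intro power_mono) auto
    then have "\<Omega>\<^sup>2 * (rad p)\<^sup>2 \<le> \<Omega>\<^sup>2 * R\<^sup>2" by (intro mult_left_mono) auto
    also have "\<dots> = L * R" using Omega by (simp add: R power2_eq_square)
    finally show ?thesis using small(1) by simp
  qed
  moreover have "0 \<le> Aprime f (\<rho> p)" using Aprime_nonneg[OF F(1)] p(3) by simp
  ultimately show ?thesis using balance[OF p(1,3)] c small(2)[of p] by linarith
qed

end

section \<open>Choice of the threshold and exclusion of fast rotation\<close>

theorem theorem5:
  fixes f :: "real \<Rightarrow> real" and K :: "(real^3) set" and \<rho>K :: "real^3 \<Rightarrow> real"
    and q M :: real
  assumes "F1 f" "F2 f" "F3 f" "F4 f"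
    and "open K" "connected K" "bounded K" "axisym_set K"
    and "q > 3"
    and "\<rho>K measurable_on K" "(\<lambda>y. \<bar>\<rho>K y\<bar> powr q) integrable_on K"
    and "\<forall>y\<in>K. \<rho>K y \<ge> 0" "axisym_fun_on K \<rho>K"
    and "no_trapping K"
    and "M > 0"
  shows "\<exists>\<Omega>0>0. \<forall>\<Omega>>\<Omega>0. \<not> (\<exists>\<rho> :: real^3 \<Rightarrow> real.
            continuous_on (- K) \<rho> \<and> bounded (\<rho> ` (- K)) \<and> (\<forall>x\<in>- K. \<rho> x \<ge> 0)
          \<and> \<rho> integrable_on (- K) \<and> integral (- K) \<rho> = M
          \<and> (\<exists>c::real. \<forall>x\<in>- K. \<rho> x > 0 \<longrightarrow>
                 Aprime f (\<rho> x) - Bop K \<rho> x - (1/2) * \<Omega>^2 * (rad x)^2 - PhiK K \<rho>K x = c))"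
proof -
  note F12 = \<open>F1 f\<close> \<open>F2 f\<close>

  \<comment> \<open>The density of the body and its potential\<close>
  define wK where "wK = (\<lambda>y. indicator K y * \<rho>K y)"
  define mK where "mK = (\<integral>y. wK y \<partial>lebesgue)"
  have Kl: "K \<in> sets lebesgue" using \<open>open K\<close> by simp
  have wK_nonneg: "wK y \<ge> 0" for y using \<open>\<forall>y\<in>K. \<rho>K y \<ge> 0\<close> by (simp add: wK_def indicator_def)
  have wK_out: "wK y = 0" if "y \<notin> K" for y using that by (simp add: wK_def)
  have "\<rho>K \<in> borel_measurable (lebesgue_on K)"
    using \<open>\<rho>K measurable_on K\<close> Kl by (simp add: measurable_on_iff_borel_measurable)
  then have wK_meas: "wK \<in> borel_measurable lebesgue"
    using Kl by (simp add: borel_measurable_restrict_space_iff wK_def)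
  have "(\<lambda>y. \<bar>\<rho>K y\<bar> powr q) absolutely_integrable_on K"
    using assms(11) by (rule nonnegative_absolutely_integrable_1) simp
  moreover have "indicator K y *\<^sub>R (\<bar>\<rho>K y\<bar> powr q) = wK y powr q" for y
    using \<open>\<forall>y\<in>K. \<rho>K y \<ge> 0\<close> by (simp add: wK_def indicator_def)
  ultimately have wK_q: "integrable lebesgue (\<lambda>y. wK y powr q)"
    by (simp add: set_integrable_def)
  obtain LK where LK: "tame_density wK LK"
    by (rule Lq_density_tame[OF wK_nonneg wK_meas wK_out \<open>bounded K\<close> \<open>q > 3\<close> wK_q])
  interpret K: tame_density wK LK by (rule LK)
  define \<Phi> where "\<Phi> = newton_potential wK"
  have PhiK_eq: "PhiK K \<rho>K x = \<Phi> x" for x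
    using integral_eq_newton_potential[OF LK[unfolded wK_def], of x]
    by (simp add: PhiK_def \<Phi>_def wK_def)
  have mK: "mK \<ge> 0" unfolding mK_def by (rule K.integral_nonneg)
  have LK0: "LK \<ge> 0"
    using K.integral_sq_le[of 0] Bochner_Integration.integral_nonneg[of lebesgue "\<lambda>y. wK y / (dist 0 y)\<^sup>2"] wK_nonneg
    by (meson divide_nonneg_nonneg order_trans zero_le_power2)
  have wK_sym: "wK (rot3 pi y) = wK y" for y
  proof (cases "y \<in> K")
    case True
    then have "rot3 pi y \<in> K" "\<rho>K (rot3 pi y) = \<rho>K y"
      using \<open>axisym_set K\<close> \<open>axisym_fun_on K \<rho>K\<close> unfolding axisym_set_def axisym_fun_on_def by blast+
    then show ?thesis using True by (simp add: wK_def)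
  next
    case False
    then have "rot3 pi y \<notin> K" using \<open>axisym_set K\<close> unfolding axisym_set_def by blast
    then show ?thesis using False wK_out by simp
  qed
  obtain D where D: "K \<subseteq> ball 0 D" "D > 0" using \<open>bounded K\<close> bounded_subset_ballD by blast

  obtain C1 where C1: "C1 \<ge> 0"
    "\<And>(x::real^3) a. a > 0 \<Longrightarrow> integrable lebesgue (\<lambda>y. indicator (ball x a) y * dist x y powr (-1))"
    "\<And>(x::real^3) a. a > 0 \<Longrightarrow>
       integral\<^sup>L lebesgue (\<lambda>y. indicator (ball x a) y * dist x y powr (-1)) \<le> C1 * a powr (3-1)"
    using riesz_kernel_near_bound[of 1] by auto
  obtain C2 where C2: "C2 \<ge> 0"
    "\<And>x::real^3. integrable lebesgue (\<lambda>y. indicator (ball x 1) y * dist x y powr (-2))"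
    "\<And>x::real^3. integral\<^sup>L lebesgue (\<lambda>y. indicator (ball x 1) y * dist x y powr (-2)) \<le> C2"
  proof -
    obtain C where C: "C \<ge> 0"
      "\<And>(x::real^3) a. a > 0 \<Longrightarrow> integrable lebesgue (\<lambda>y. indicator (ball x a) y * dist x y powr (-2))"
      "\<And>(x::real^3) a. a > 0 \<Longrightarrow>
         integral\<^sup>L lebesgue (\<lambda>y. indicator (ball x a) y * dist x y powr (-2)) \<le> C * a powr (3-2)"
      using riesz_kernel_near_bound[of 2] by auto
    show thesis
      by (rule that[OF C(1) C(2)[OF zero_less_one]]) (use C(3)[OF zero_less_one] in simp)
  qed
  obtain C3 where C3: "C3 \<ge> 0"
    "\<And>(x::real^3) R. R > 0 \<Longrightarrow>
       integrable lebesgue (\<lambda>y. indicator {y. rad y \<le> R} y * cyl_kernel R (dist x y))"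
    "\<And>(x::real^3) R. R > 0 \<Longrightarrow>
       integral\<^sup>L lebesgue (\<lambda>y. indicator {y. rad y \<le> R} y * cyl_kernel R (dist x y)) \<le> C3 * R"
    using cylinder_kernel_bound by blast

  \<comment> \<open>Constants depending on the data only, not on \<Omega> or the star\<close>
  define CB where "CB = C1 + M"
  define CP where "CP = mK + LK"
  \<comment> \<open>One more than the bound which \<open>density_le_uniform\<close> requires to be
    exceeded; (F2) at infinity then provides \<open>s0\<close>.\<close>
  define N where "N = Aprime f 1 + CP + 2 * CB + 1"
  have CB: "CB \<ge> 0" and CP: "CP \<ge> 0" using C1(1) \<open>M > 0\<close> mK LK0 by (auto simp: CB_def CP_def)
  obtain s0 where s0: "s0 \<ge> 1" "\<And>s. s \<ge> s0 \<Longrightarrow> f s / s \<ge> N * s powr (1/3)"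
  proof -
    have "eventually (\<lambda>s. N \<le> f s / s powr (4/3)) at_top"
      using \<open>F2 f\<close> by (simp add: F2_def filterlim_at_top)
    then obtain b where b: "\<And>s. s \<ge> b \<Longrightarrow> N \<le> f s / s powr (4/3)"
      by (auto simp: eventually_at_top_linorder)
    show thesis
    proof (rule that[of "max 1 b"])
      fix s assume s: "s \<ge> max 1 b"
      have "s powr (4/3) = s powr (1/3) * s"
        using s powr_add[of s "1/3" 1] by simp
      then show "N * s powr (1/3) \<le> f s / s"
        using b[of s] s by (simp add: field_simps)
    qed simp
  qed
  define S where "S = 2 * s0"
  define LB where "LB = C2 * S + M"
  define L where "L = LB + LK"
  have S: "S > 0" using s0 by (simp add: S_def)
  have LB: "LB \<ge> 0" using C2(1) S \<open>M > 0\<close> by (simp add: LB_def)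
  have L: "L \<ge> 0" using LB LK0 by (simp add: L_def)

  \<comment> \<open>Points of norm below \<open>D + 1\<close> have distance at most
    \<open>2 * D + 1\<close> from \<open>K\<close>, so \<open>\<Phi>\<close> is at least
    \<open>c0\<close> there. Beyond norm \<open>Z\<close> the distance to \<open>K\<close> exceeds
    \<open>4 * mK / c0\<close> and \<open>\<Phi>\<close> is below \<open>c0 / 4\<close>. The length
    \<open>T\<close> makes the far share \<open>M / T\<close> of \<open>B\<close> equal to
    \<open>c0 / 24\<close>.\<close>
  define c0 where "c0 = mK / (2 * D + 1)"
  define Z where "Z = D + 4 * mK / c0 + 1"
  define T where "T = 24 * M / c0"
  \<comment> \<open>First \<open>a\<close> is fixed, then the bound \<open>b\<close> on the radius
    is chosen depending on \<open>a\<close>, \<open>T\<close> and \<open>Z\<close>. For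
    \<open>mK = 0\<close> also \<open>c0 = 0\<close>, so the smallness conditions are imposed only
    for positive \<open>mK\<close>.\<close>
  obtain a b where ab: "a > 0" "b > 0" "mK > 0 \<Longrightarrow> C1 * S * a\<^sup>2 \<le> c0 / 24"
    "\<And>R. mK > 0 \<Longrightarrow> 0 < R \<Longrightarrow> R < b \<Longrightarrow>
       L * R \<le> c0 / 4 \<and> S * (8 * R\<^sup>2 * T) / a \<le> c0 / 24 \<and> S * (8 * R\<^sup>2 * Z) < M"
  proof (cases "mK > 0")
    case False
    then show thesis using that[of 1 1] by simp
  next
    case True
    then have c0: "c0 > 0" using D(2) by (simp add: c0_def)
    have "((\<lambda>a::real. C1 * S * a\<^sup>2) \<longlongrightarrow> C1 * S * 0\<^sup>2) (at_right 0)" by (intro tendsto_intros)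
    then have "eventually (\<lambda>a. C1 * S * a\<^sup>2 < c0 / 24) (at_right 0)"
      by (rule order_tendstoD) (use c0 in simp)
    then obtain a' where "a' > 0" "\<And>a. 0 < a \<Longrightarrow> a < a' \<Longrightarrow> C1 * S * a\<^sup>2 < c0 / 24"
      unfolding eventually_at_right_field by blast
    then obtain a where a: "a > 0" "C1 * S * a\<^sup>2 < c0 / 24"
      using field_lbound_gt_zero[of a' a'] by (metis half_gt_zero field_sum_of_halves less_add_same_cancel1)
    have "((\<lambda>R::real. L * R) \<longlongrightarrow> L * 0) (at_right 0)" by (intro tendsto_intros)
    then have e1: "eventually (\<lambda>R. L * R < c0 / 4) (at_right 0)"
      by (rule order_tendstoD) (use c0 in simp)
    have "((\<lambda>R::real. S * (8 * R\<^sup>2 * T) / a) \<longlongrightarrow> S * (8 * 0\<^sup>2 * T) / a) (at_right 0)"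
      by (intro tendsto_intros) (use a in simp)
    then have e2: "eventually (\<lambda>R. S * (8 * R\<^sup>2 * T) / a < c0 / 24) (at_right 0)"
      by (rule order_tendstoD) (use c0 in simp)
    have "((\<lambda>R::real. S * (8 * R\<^sup>2 * Z)) \<longlongrightarrow> S * (8 * 0\<^sup>2 * Z)) (at_right 0)"
      by (intro tendsto_intros)
    then have e3: "eventually (\<lambda>R. S * (8 * R\<^sup>2 * Z) < M) (at_right 0)"
      by (rule order_tendstoD) (use \<open>M > 0\<close> in simp)
    have "eventually (\<lambda>R. L * R \<le> c0 / 4 \<and> S * (8 * R\<^sup>2 * T) / a \<le> c0 / 24 \<and> S * (8 * R\<^sup>2 * Z) < M) (at_right 0)"
      using e1 e2 e3 by eventually_elim auto
    then obtain b where "b > 0" "\<And>R. 0 < R \<Longrightarrow> R < b \<Longrightarrow>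
       L * R \<le> c0 / 4 \<and> S * (8 * R\<^sup>2 * T) / a \<le> c0 / 24 \<and> S * (8 * R\<^sup>2 * Z) < M"
      unfolding eventually_at_right_field by blast
    then show thesis using that[of a b] a by simp
  qed
  \<comment> \<open>The 1 ensures that the square of \<Omega> is at least \<Omega>, the next two
    terms serve \<open>widest_point_contradiction\<close>, and \<open>L / b\<close> forces the
    radius \<open>L / \<Omega>\<^sup>2\<close> below \<open>b\<close>.\<close>
  define \<Omega>0 where "\<Omega>0 = 1 + mK + 2 * C3 * S + L / b"
  have Om0: "\<Omega>0 \<ge> 1" using mK C3(1) S L ab(2) by (simp add: \<Omega>0_def add_nonneg_nonneg)

  \<comment> \<open>Contradiction from a star with \<Omega> above the threshold\<close>
  have no_star: False
    if \<Omega>: "\<Omega> > \<Omega>0" and cont: "continuous_on (- K) \<rho>" and bdd: "bounded (\<rho> ` (- K))"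
      and nonneg: "\<forall>x\<in>- K. \<rho> x \<ge> 0" and int: "\<rho> integrable_on (- K)" "integral (- K) \<rho> = M"
      and eq: "\<forall>x\<in>- K. \<rho> x > 0 \<longrightarrow>
         Aprime f (\<rho> x) - Bop K \<rho> x - (1/2) * \<Omega>^2 * (rad x)^2 - PhiK K \<rho>K x = c" for \<Omega> \<rho> c
  proof -
    have "\<Omega> \<le> \<Omega>\<^sup>2" using \<Omega> Om0 by (simp add: power2_eq_square)
    then have Om2: "\<Omega>\<^sup>2 > \<Omega>0" using \<Omega> by linarith
    obtain \<sigma> where \<sigma>: "\<sigma> > 0" "\<And>x. x \<notin> K \<Longrightarrow> \<rho> x \<le> \<sigma>"
    proof -
      obtain s where s: "\<forall>x\<in>\<rho> ` (- K). norm x \<le> s" using bdd by (auto simp: bounded_iff)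
      show thesis
      proof (rule that[of "max s 1"])
        fix x assume "x \<notin> K"
        then have "\<bar>\<rho> x\<bar> \<le> s" using s by simp
        then show "\<rho> x \<le> max s 1" by (simp add: abs_le_iff le_max_iff_disj)
      qed simp
    qed
    define w where "w = (\<lambda>y. indicator (- K) y * \<rho> y)"
    have w_nonneg: "w y \<ge> 0" for y using nonneg by (simp add: w_def indicator_def)
    have "\<rho> absolutely_integrable_on (- K)"
      using int(1) nonneg by (intro nonnegative_absolutely_integrable_1) auto
    then have w_int: "integrable lebesgue w" and w_M: "(\<integral>y. w y \<partial>lebesgue) = M"
      using set_lebesgue_integral_eq_integral(2)[of "- K" \<rho>] int(2)
      by (simp_all add: set_integrable_def set_lebesgue_integral_def w_def)
    have w_le: "AE y in lebesgue. w y \<le> s" if "\<And>x. x \<notin> K \<Longrightarrow> rad x > 0 \<Longrightarrow> \<rho> x \<le> s" "s \<ge> 0" for s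
      using AE_rad_pos by eventually_elim (use that in \<open>auto simp: w_def indicator_def\<close>)
    have w_supp: "AE y in lebesgue. w y \<noteq> 0 \<longrightarrow> P y" if "\<And>x. x \<notin> K \<Longrightarrow> rad x > 0 \<Longrightarrow> \<rho> x > 0 \<Longrightarrow> P x" for P
      using AE_rad_pos
    proof eventually_elim
      case (elim y)
      show ?case using that[of y] w_nonneg[of y] elim by (auto simp: w_def indicator_def split: if_splits)
    qed
    define B where "B = newton_potential w"
    \<comment> \<open>A first pass with the crude bound \<open>\<sigma>\<close> identifies
      \<open>Bop\<close> with a potential. It opens the way to the uniform bound \<open>S\<close>,
      with which tameness is established anew.\<close>
    have tame\<sigma>: "tame_density w (C2 * \<sigma> + M)"
      using bounded_density_tame[OF w_nonneg w_int w_le _ C2(2,3)] \<sigma> w_M by auto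
    then have Bop_eq: "Bop K \<rho> x = B x" for x
      using integral_eq_newton_potential[of "- K" \<rho> _ x] by (simp add: Bop_def B_def w_def)
    interpret rotating_star f K \<rho> B \<Phi> \<Omega> c \<sigma>
    proof
      fix x assume "x \<notin> K" "\<rho> x > 0"
      then show "Aprime f (\<rho> x) = B x + \<Omega>\<^sup>2 * (rad x)\<^sup>2 / 2 + \<Phi> x + c"
        using eq unfolding Bop_eq PhiK_eq by force
    qed (use F12 assms(14) cont \<sigma>(2) \<Omega> Om0 tame_density.newton_potential_nonneg[OF tame\<sigma>]
        K.newton_potential_nonneg in \<open>auto simp: B_def \<Phi>_def\<close>)
    have rho_le_S: "\<rho> x \<le> S" if "x \<notin> K" "rad x > 0" for x
      unfolding S_def
    proof (rule density_le_uniform[OF s0(2,1) _ _ CB CP _ that])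
      show "\<Phi> x \<le> CP" for x unfolding \<Phi>_def CP_def mK_def by (rule K.newton_potential_le)
      show "B x \<le> CB * s powr (1/3)" if "s > 0" "\<forall>x. x \<notin> K \<longrightarrow> rad x > 0 \<longrightarrow> \<rho> x \<le> s" for s x
        unfolding B_def CB_def w_M[symmetric]
        by (rule bounded_density_potential_le[OF w_nonneg w_int w_le that(1) C1(2,3)]) (use that in auto)
    qed (simp_all add: N_def)
    have ae_S: "AE y in lebesgue. w y \<le> S" using w_le[OF rho_le_S] S by simp
    have tame: "tame_density w LB"
      using bounded_density_tame[OF w_nonneg w_int ae_S _ C2(2,3)] S w_M by (simp add: LB_def)
    interpret w: tame_density w LB by (rule tame)
    note lip = w.newton_potential_diff_le[folded B_def] K.newton_potential_diff_le[folded \<Phi>_def]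
    define R where "R = L / \<Omega>\<^sup>2"
    have thin: "rad x < R" if "x \<notin> K" "rad x > 0" "\<rho> x > 0" for x
      using rad_less[OF lip that] by (simp add: R_def L_def)
    have "\<exists>x. x \<notin> K \<and> rad x > 0 \<and> \<rho> x > 0"
    proof (rule ccontr)
      assume "\<not> ?thesis"
      then have "AE y in lebesgue. w y \<noteq> 0 \<longrightarrow> False" by (intro w_supp) blast
      then have "(\<integral>y. w y \<partial>lebesgue) = (\<integral>y. 0 \<partial>(lebesgue :: (real^3) measure))"
        using w_int by (intro integral_cong_AE) auto
      then show False using w_M \<open>M > 0\<close> by simp
    qed
    then obtain x0 where x0: "x0 \<notin> K" "rad x0 > 0" "\<rho> x0 > 0" by blast
    have R: "0 < R" "R < b"
    proof -
      show "0 < R" using thin[OF x0] x0(2) by linarith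
      have "L / b < \<Omega>\<^sup>2" 
      proof -
        have "2 * C3 * S \<ge> 0" using C3(1) S by simp
        then show ?thesis using Om2 mK unfolding \<Omega>0_def by linarith
      qed
      then show "R < b" using ab(2) Omega by (simp add: R_def field_simps)
    qed
    \<comment> \<open>Otherwise either \<open>\<Phi>\<close> vanishes or the star, off the axis,
      keeps distance at least 1 from \<open>K\<close>, as the half-turn estimate asks. In both cases
      the widest point gives a contradiction.\<close>
    have "mK > 0 \<and> (\<exists>p. p \<notin> K \<and> rad p > 0 \<and> \<rho> p > 0 \<and> norm p < D + 1)"
    proof (rule ccontr)
      assume far: "\<not> ?thesis"
      show False
      proof (rule widest_point_contradiction[OF B_def w_def tame rho_le_S _ _ C3(1) x0 C3(2,3)])
        fix p t assume p: "p \<notin> K" "rad p > 0" "\<rho> p > 0" "t > 0" "push_out t p \<notin> K"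
        show "\<Phi> p - \<Phi> (push_out t p) \<le> ((rad (push_out t p))\<^sup>2 - (rad p)\<^sup>2) / 2 * mK"
        proof (cases "mK > 0")
          case True
          then have "norm p \<ge> D + 1" using far p by force
          have "dist p y \<ge> 1" if "wK y \<noteq> 0" for y
          proof -
            have "norm y < D" using that wK_out D(1) by fastforce
            then show ?thesis using \<open>norm p \<ge> D + 1\<close> norm_triangle_ineq2[of p y] by (simp add: dist_norm)
          qed
          then show ?thesis unfolding \<Phi>_def mK_def
            using wK_sym p wK_out by (intro K.newton_potential_push_out_diff_le) auto
        next
          case False
          then have m0: "mK = 0" using mK by simp
          then have "AE y in lebesgue. wK y = 0"
            using integral_nonneg_eq_0_iff_AE[OF K.integrable] wK_nonneg by (simp add: mK_def)
          then have "\<Phi> x = 0" for x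
            unfolding \<Phi>_def newton_potential_def
            by (intro integral_eq_zero_AE) auto
          then show ?thesis using m0 by simp
        qed
      next
        show "\<Omega>\<^sup>2 \<ge> mK + 2 * C3 * S"
        proof -
          have "L / b \<ge> 0" using L ab(2) by simp
          then show ?thesis using Om2 unfolding \<Omega>0_def by linarith
        qed
      qed (use S thin in \<open>auto intro: less_imp_le\<close>)
    qed
    then obtain p0 where m: "mK > 0" and p0: "p0 \<notin> K" "rad p0 > 0" "\<rho> p0 > 0" "norm p0 < D + 1" by blast
    have c0: "c0 > 0" using m D(2) by (simp add: c0_def)
    have T: "T > 0" using c0 \<open>M > 0\<close> by (simp add: T_def)
    have small: "L * R \<le> c0 / 4" "S * (8 * R\<^sup>2 * T) / a \<le> c0 / 24" "S * (8 * R\<^sup>2 * Z) < M"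
      using ab(4)[OF m R] by auto
    \<comment> \<open>Each of the three zones of the thin-cylinder estimate contributes at most
      \<open>c0 / 24\<close>.\<close>
    have B_small: "B x \<le> c0 / 8" for x
    proof -
      have "B x \<le> C1 * S * a\<^sup>2 + S * (8 * R\<^sup>2 * T) / a + M / T"
        unfolding B_def w_M[symmetric]
        by (rule w.newton_potential_thin_cylinder_le[OF ae_S _ w_supp _ ab(1) T C1(2,3)[OF ab(1)]])
          (use S R(1) thin in \<open>auto intro: less_imp_le\<close>)
      moreover have "M / T = c0 / 24" using \<open>M > 0\<close> c0 by (simp add: T_def)
      ultimately show ?thesis using ab(3)[OF m] small(2) by linarith
    qed
    have Phi_p0: "\<Phi> p0 \<ge> c0"
    proof -
      have "c0 = (\<integral>y. wK y / (2 * D + 1) \<partial>lebesgue)" by (simp add: c0_def mK_def)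
      also have "\<dots> \<le> \<Phi> p0" unfolding \<Phi>_def newton_potential_def
      proof (rule integral_mono)
        fix y
        show "wK y / (2 * D + 1) \<le> wK y / dist p0 y"
        proof (cases "y \<in> K")
          case True
          then have "norm y < D" using D(1) by auto
          then have "dist p0 y \<le> 2 * D + 1" using norm_triangle_ineq4[of p0 y] p0(4) by (simp add: dist_norm)
          moreover have "dist p0 y > 0" using True p0(1) by auto
          ultimately show ?thesis using wK_nonneg[of y] D(2) by (intro divide_left_mono mult_pos_pos) auto
        qed (simp add: wK_out)
      qed (use K.integrable K.integrable_newton in auto)
      finally show ?thesis .
    qed
    \<comment> \<open>Far from \<open>K\<close> the potential of the body decays below the level
      \<open>c0 / 4\<close> that the whole star must maintain.\<close>
    have Z: "norm p \<le> Z" if p: "p \<notin> K" "rad p > 0" "\<rho> p > 0" for p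
    proof (rule ccontr)
      assume "\<not> norm p \<le> Z"
      define e where "e = norm p - D"
      have e: "e > 4 * mK / c0" using \<open>\<not> norm p \<le> Z\<close> by (simp add: e_def Z_def)
      then have e0: "e > 0" using m c0 by (smt (verit) divide_pos_pos)
      have "\<Phi> p \<le> (\<integral>y. wK y / e \<partial>lebesgue)" unfolding \<Phi>_def newton_potential_def
      proof (rule integral_mono)
        fix y
        show "wK y / dist p y \<le> wK y / e"
        proof (cases "y \<in> K")
          case True
          then have "norm y < D" using D(1) by auto
          then have "e \<le> dist p y" using norm_triangle_ineq2[of p y] by (simp add: dist_norm e_def)
          then show ?thesis using wK_nonneg[of y] e0 by (intro divide_left_mono mult_pos_pos) auto
        qed (simp add: wK_out)
      qed (use K.integrable K.integrable_newton in auto)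
      also have "\<dots> = mK / e" by (simp add: mK_def)
      also have "\<dots> < c0 / 4" using e e0 c0 by (simp add: field_simps)
      finally have "\<Phi> p < c0 / 4" .
      moreover have "\<Phi> p \<ge> c0 / 4"
        by (rule Phi_ge_of_near_point[OF lip L_def L R_def small(1) B_small c0 p0(1-3) Phi_p0 p])
      ultimately show False by simp
    qed
    \<comment> \<open>The star now fits into a bounded piece of a thin cylinder, too small for the
      mass \<open>M\<close> at density \<open>S\<close>.\<close>
    have "M \<le> S * (8 * R\<^sup>2 * Z)"
      unfolding w_M[symmetric]
    proof (rule w.integral_le_of_cylinder_segment[OF ae_S _ w_supp])
      show "Z \<ge> 0" using order_trans[OF norm_ge_zero Z[OF x0]] .
    qed (use S R(1) thin Z in \<open>auto intro: less_imp_le\<close>)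
    then show False using small(3) by simp
  qed
  show ?thesis
  proof (intro exI[of _ \<Omega>0] conjI allI impI notI)
    show "\<Omega>0 > 0" using Om0 by simp
  qed (elim exE conjE, rule no_star)
qed

end
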